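(* Let $X_n$, $n\in\mathbb N$, be a sequence of non-empty Polish spaces and let $\psi_n:X_n^2\to\mathbb R^+$ be Borel functions such that the relation $E=E((X_n,\psi_n)_{n\in\mathbb N})$ on $\prod_{n\in\mathbb N}X_n$ is an equivalence relation. If $E\le_B\mathbb R^{\mathbb N}/\ell_1$, then either $E\le_B E_0$ or $E\sim_B\mathbb R^{\mathbb N}/\ell_1$.
   Context: $\mathbb R^+$ denotes the set of non-negative real numbers. For non-empty sets $X_n$ and functions $\psi_n:X_n^2\to\mathbb R^+$, the relation $E((X_n,\psi_n)_{n\in\mathbb N})$ on $\prod_{n\in\mathbb N}X_n$ is defined by $(x,y)\in E((X_n,\psi_n)_{n\in\mathbb N})\iff\sum_{n\in\mathbb N}\psi_n(x(n),y(n))<+\infty$. When the $X_n$ are Polish, $\prod_n X_n$ carries the product topology. For equivalence relations $E,F$ on Polish spaces $X,Y$, $E\le_B F$ means that there is a Borel function $\theta:X\to Y$ with $(x,y)\in E\iff(\theta(x),\theta(y))\in F$ for all $x,y\in X$; $E\sim_B F$ means $E\le_B F$ and $F\le_B E$. $\mathbb R^{\mathbb N}/\ell_1$ is the equivalence relation on $\mathbb R^{\mathbb N}$ given by $(x,y)\in\mathbb R^{\mathbb N}/\ell_1\iff x-y\in\ell_1$. $E_0$ is the equivalence relation on $2^{\mathbb N}$ given by $(x,y)\in E_0\iff\exists m\,\forall n\ge m\,(x(n)=y(n))$. *)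

theory Defs
  imports "HOL-Analysis.Analysis"
begin

text \<open>
  Spaces are values of type \<^typ>\<open>'a topology\<close> rather than instances of a type class, so that
  the members of a sequence of spaces may all be different (as subsets of one common type).
\<close>

definition polish_topology :: "'a topology \<Rightarrow> bool" where
  "polish_topology X \<longleftrightarrow> completely_metrizable_space X \<and> separable_space X"

definition borel_of :: "'a topology \<Rightarrow> 'a measure" where
  "borel_of X = sigma (topspace X) {U. openin X U}"

definition borel_reducible ::
  "'a topology \<Rightarrow> ('a \<times> 'a) set \<Rightarrow> 'b topology \<Rightarrow> ('b \<times> 'b) set \<Rightarrow> bool" where
  "borel_reducible X E Y F \<longleftrightarrow>
     (\<exists>\<theta> \<in> borel_of X \<rightarrow>\<^sub>M borel_of Y.
        \<forall>x \<in> topspace X. \<forall>y \<in> topspace X. (x, y) \<in> E \<longleftrightarrow> (\<theta> x, \<theta> y) \<in> F)"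

definition borel_bireducible ::
  "'a topology \<Rightarrow> ('a \<times> 'a) set \<Rightarrow> 'b topology \<Rightarrow> ('b \<times> 'b) set \<Rightarrow> bool" where
  "borel_bireducible X E Y F \<longleftrightarrow> borel_reducible X E Y F \<and> borel_reducible Y F X E"

text \<open>
  The relation \<open>E((A n, \<psi> n) | n)\<close>. It is used for \<open>\<psi> n\<close> non-negative on \<open>A n \<times> A n\<close>, where
  \<^const>\<open>summable\<close> says that the sum is finite.
\<close>

definition sum_rel ::
  "(nat \<Rightarrow> 'a set) \<Rightarrow> (nat \<Rightarrow> 'a \<times> 'a \<Rightarrow> real) \<Rightarrow> ((nat \<Rightarrow> 'a) \<times> (nat \<Rightarrow> 'a)) set" where
  "sum_rel A \<psi> = {(x, y). x \<in> (\<Pi>\<^sub>E n\<in>UNIV. A n) \<and> y \<in> (\<Pi>\<^sub>E n\<in>UNIV. A n) \<and>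
     summable (\<lambda>n. \<psi> n (x n, y n))}"

definition ell1 :: "(nat \<Rightarrow> real) set" where
  "ell1 = {x. summable (\<lambda>n. \<bar>x n\<bar>)}"

definition RN_mod_ell1 :: "((nat \<Rightarrow> real) \<times> (nat \<Rightarrow> real)) set" where
  "RN_mod_ell1 = {(x, y). (\<lambda>n. x n - y n) \<in> ell1}"

abbreviation cantor_topology :: "(nat \<Rightarrow> bool) topology" where
  "cantor_topology \<equiv> product_topology (\<lambda>_. discrete_topology UNIV) UNIV"

definition E0 :: "((nat \<Rightarrow> bool) \<times> (nat \<Rightarrow> bool)) set" where
  "E0 = {(x, y). \<exists>m. \<forall>n\<ge>m. x n = y n}"

end

theory Submission
  imports Defs "HOL-Probability.Probability"
begin

text \<open>
  Suppose first that no \<open>\<delta> > 0\<close> makes the suprema of the values of \<open>\<psi> n\<close> below \<open>\<delta>\<close> summable. Then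
  there are pairs \<open>(u n, v n)\<close> and disjoint finite blocks of indices over which \<open>\<psi> n (u n, v n)\<close> sums
  up to about \<open>1\<close>, with terms tending to \<open>0\<close>. A number in \<open>[0, 1]\<close> is coded by an initial segment of a
  block, and this reduces \<open>\<real>\<^sup>\<nat> / \<ell>\<^sub>1\<close> to \<open>E\<close>.

  Otherwise \<open>E\<close> says that \<open>(x n, y n) \<in> F n\<close> for almost all \<open>n\<close>, where \<open>F n\<close> is a Borel equivalence
  relation for large \<open>n\<close>. If almost all \<open>F n\<close> have countably many classes, then \<open>E\<close> reduces to \<open>E0\<close> by
  recording the index of the class of \<open>x n\<close> in unary. If infinitely many have uncountably many
  classes, each of these admits a continuous image of \<open>2\<^sup>\<nat>\<close> on which changing exactly one bit
  changes the class. A reduction to \<open>\<real>\<^sup>\<nat> / \<ell>\<^sub>1\<close> then gives measurable functions of an infinite matrix of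
  fair coin tosses, and changing one bit that lies far out in its row moves their values by little in
  \<open>\<ell>\<^sub>1\<close>, outside a set of small measure. Changing one such bit in every row therefore produces
  inequivalent points with equivalent images.
\<close>

section \<open>Flipping coin tosses\<close>

text \<open>The coin tosses give no control over the point of the matrix or over the bit chosen in a
  row. Hence the maps of Cantor space into the spaces must change the class at every point and under
  every single bit change; this is a weak form of the perfect set of inequivalent points in Silver's
  theorem. Three obstacles shape the proof. Inequivalence is a Borel but not a closed condition, so
  limits of inequivalent points may become equivalent; the complement of \<open>F n\<close> is
  therefore written as a projection of a closed set, and the witnesses are made to converge together
  with the points. The reduction is only measurable, so its value after infinitely many bit changes
  is not a limit of values after finitely many; it needs an estimate of its own, and a point that
  satisfies all estimates comes from Borel-Cantelli. Finally, a single \<open>\<psi> n\<close> need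
  not be symmetric, vanish on the diagonal or satisfy a triangle inequality. Such properties are
  available only for \<open>E\<close>, and are brought down to the coordinates by assembling values
  at all \<open>n\<close> into points of the product.\<close>

definition bit_space :: "('i \<Rightarrow> bool) measure" where
  "bit_space = (\<Pi>\<^sub>M i\<in>UNIV. measure_pmf (pmf_of_set UNIV))"

definition flip :: "'i set \<Rightarrow> ('i \<Rightarrow> bool) \<Rightarrow> 'i \<Rightarrow> bool" where
  "flip A x = (\<lambda>i. if i \<in> A then \<not> x i else x i)"

lemma space_bit_space [simp]: "space bit_space = UNIV"
  by (simp add: bit_space_def space_PiM)

interpretation bits: prob_space "bit_space :: ('i \<Rightarrow> bool) measure"
proof -
  interpret product_prob_space "\<lambda>_::'i. measure_pmf (pmf_of_set (UNIV :: bool set))" UNIV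
    by unfold_locales
  show "prob_space (bit_space :: ('i \<Rightarrow> bool) measure)"
    unfolding bit_space_def by unfold_locales
qed

lemma measurable_bit [measurable]: "(\<lambda>x. x i) \<in> bit_space \<rightarrow>\<^sub>M count_space UNIV"
proof -
  have "(\<lambda>x. x i) \<in> bit_space \<rightarrow>\<^sub>M measure_pmf (pmf_of_set UNIV)"
    unfolding bit_space_def by (rule measurable_component_singleton) simp
  then show ?thesis by simp
qed

lemma measurable_into_bit_space:
  assumes "\<And>i. (\<lambda>x. f x i) \<in> N \<rightarrow>\<^sub>M count_space UNIV"
  shows "f \<in> N \<rightarrow>\<^sub>M bit_space"
proof -
  have "(\<lambda>x. \<lambda>i\<in>UNIV. f x i) \<in> N \<rightarrow>\<^sub>M bit_space"
    unfolding bit_space_def by (rule measurable_restrict) (use assms in simp)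
  then show ?thesis by (simp add: restrict_def)
qed

lemma measurable_flip [measurable]: "flip A \<in> bit_space \<rightarrow>\<^sub>M bit_space"
proof (rule measurable_into_bit_space)
  show "(\<lambda>x. flip A x i) \<in> bit_space \<rightarrow>\<^sub>M count_space UNIV" for i
    by (cases "i \<in> A") (simp_all add: flip_def)
qed

text \<open>A fair coin has the same law as its negation, so the flip preserves the measure of
  cylinders over finitely many coordinates, and these determine the product measure. The set
  \<open>A\<close> may be infinite.\<close>

lemma distr_flip: "distr bit_space bit_space (flip A) = (bit_space :: ('i \<Rightarrow> bool) measure)"
proof -
  define c where "c = pmf_of_set (UNIV :: bool set)"
  interpret product_prob_space "\<lambda>_::'i. measure_pmf c" UNIV
    by unfold_locales
  have bs: "bit_space = PiM UNIV (\<lambda>_::'i. measure_pmf c)"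
    by (simp add: bit_space_def c_def)
  have Not: "map_pmf Not c = c"
    unfolding c_def by (subst map_pmf_of_set_inj) (auto simp: inj_def surjI[of _ Not])
  have coord: "emeasure c ((\<lambda>b. if i \<in> A then \<not> b else b) -` F) = emeasure c F" for i F
  proof (cases "i \<in> A")
    case True
    have "emeasure c F = emeasure (map_pmf Not c) F" by (simp add: Not)
    then show ?thesis using True by simp
  qed simp
  have "distr bit_space bit_space (flip A) = PiM UNIV (\<lambda>_::'i. measure_pmf c)"
  proof (rule PiM_eq)
    show "sets (distr bit_space bit_space (flip A)) = sets (PiM UNIV (\<lambda>_::'i. measure_pmf c))"
      by (simp add: bs)
    fix J :: "'i set" and F
    assume J: "finite J" "J \<subseteq> UNIV" and F: "\<And>j. j \<in> J \<Longrightarrow> F j \<in> sets (measure_pmf c)"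
    let ?G = "\<lambda>i. (\<lambda>b. if i \<in> A then \<not> b else b) -` F i"
    have "emeasure (distr bit_space bit_space (flip A)) (prod_emb UNIV (\<lambda>_. measure_pmf c) J (Pi\<^sub>E J F))
      = emeasure bit_space (flip A -` (prod_emb UNIV (\<lambda>_. measure_pmf c) J (Pi\<^sub>E J F)))"
      by (subst emeasure_distr) (use J F in \<open>auto simp: bs[symmetric] intro!: sets_PiM_I[of J UNIV _ "\<lambda>_. measure_pmf c", folded bs]\<close>)
    also have "flip A -` (prod_emb UNIV (\<lambda>_. measure_pmf c) J (Pi\<^sub>E J F))
       = prod_emb UNIV (\<lambda>_. measure_pmf c) J (Pi\<^sub>E J ?G)"
      by (auto simp: prod_emb_def flip_def PiE_def Pi_def split: if_splits)
    also have "emeasure bit_space \<dots> = (\<Prod>j\<in>J. emeasure c (?G j))"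
      unfolding bs by (rule emeasure_PiM_emb) (use J in auto)
    finally show "emeasure (distr bit_space bit_space (flip A)) (prod_emb UNIV (\<lambda>_. measure_pmf c) J (Pi\<^sub>E J F))
       = (\<Prod>j\<in>J. emeasure c (F j))"
      by (simp only: coord)
  qed
  then show ?thesis by (simp add: bs)
qed

lemma prob_flip:
  assumes "S \<in> sets bit_space"
  shows "bits.prob (flip A -` S) = bits.prob S"
proof -
  have "bits.prob S = measure (distr bit_space bit_space (flip A)) S"
    by (simp add: distr_flip)
  also have "\<dots> = bits.prob (flip A -` S)"
    by (subst measure_distr) (use assms in simp_all)
  finally show ?thesis by simp
qed

lemma sets_flip [measurable (raw)]:
  assumes "S \<in> sets bit_space"
  shows "flip A -` S \<in> sets bit_space"
  using measurable_sets[OF measurable_flip assms] by simp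

section \<open>Flips of far-out coordinates hardly move sets and functions\<close>

lemma sets_bit_space_eq:
  "sets bit_space = sigma_sets UNIV {{x :: 'i \<Rightarrow> bool. x i \<in> B} | i B. True}"
  unfolding bit_space_def sets_PiM_single by (simp add: PiE_UNIV_domain)

text \<open>Each coordinate lies in only finitely many of the sets, while the sets themselves may be
  infinite. Both single bits moving out along a row and tails of an infinite set of bits are of this
  kind.\<close>

definition vanishing :: "(nat \<Rightarrow> 'i set) \<Rightarrow> bool" where
  "vanishing A \<longleftrightarrow> (\<forall>i. \<forall>\<^sub>F n in sequentially. i \<notin> A n)"

text \<open>The set measured is the symmetric difference of \<open>S\<close> and its preimage. It is
  empty for large \<open>n\<close> if \<open>S\<close> depends on one coordinate. Complements have
  the same difference set, and a countable union is a finite one up to an error whose measure the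
  flips preserve.\<close>

lemma flip_set_tendsto:
  fixes A :: "nat \<Rightarrow> 'i set"
  assumes A: "vanishing A" and S: "S \<in> sets bit_space"
  shows "(\<lambda>n. bits.prob {x. x \<in> S \<longleftrightarrow> flip (A n) x \<notin> S}) \<longlonglongrightarrow> 0"
  using S unfolding sets_bit_space_eq
proof (induction S rule: sigma_sets.induct)
  case (Basic a)
  then obtain i B where a: "a = {x. x i \<in> B}" by auto
  have "\<forall>\<^sub>F n in sequentially. bits.prob {x. x \<in> a \<longleftrightarrow> flip (A n) x \<notin> a} = 0"
    using A[unfolded vanishing_def, rule_format, of i]
    by eventually_elim (auto simp: a flip_def)
  then show ?case by (rule tendsto_eventually)
next
  case (Union a)
  have a_sets: "a k \<in> sets bit_space" for k
    unfolding sets_bit_space_eq by (rule Union.hyps)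
  note [measurable] = a_sets
  show ?case
  proof (rule LIMSEQ_I)
    fix e :: real assume e: "e > 0"
    define U where "U N = (\<Union>k\<in>{..<N}. a k)" for N
    have "(\<lambda>N. bits.prob (U N)) \<longlonglongrightarrow> bits.prob (\<Union>N. U N)"
      by (rule bits.finite_Lim_measure_incseq) (auto simp: U_def incseq_def a_sets intro: less_le_trans)
    then obtain N where "norm (bits.prob (U N) - bits.prob (\<Union>N. U N)) < e / 3"
      using LIMSEQ_D[of _ _ "e/3"] e by fastforce
    moreover have UU: "(\<Union>N. U N) = (\<Union>k. a k)"
      by (auto simp: U_def)
    moreover have [measurable]: "U N \<in> sets bit_space" "(\<Union>k. a k) \<in> sets bit_space"
      by (auto simp: U_def a_sets)
    moreover have "bits.prob ((\<Union>k. a k) - U N) = bits.prob (\<Union>k. a k) - bits.prob (U N)"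
      by (rule bits.finite_measure_Diff) (use \<open>U N \<in> sets bit_space\<close> \<open>(\<Union>k. a k) \<in> sets bit_space\<close> in \<open>auto simp: U_def\<close>)
    ultimately have small: "bits.prob ((\<Union>k. a k) - U N) < e / 3"
      by (smt (verit) real_norm_def)
    have lim: "(\<lambda>n. \<Sum>k<N. bits.prob {x. x \<in> a k \<longleftrightarrow> flip (A n) x \<notin> a k}) \<longlonglongrightarrow> 0"
      using tendsto_sum[of "{..<N}", OF Union.IH] by simp
    then obtain n0 where n0: "\<And>n. n \<ge> n0 \<Longrightarrow> norm ((\<Sum>k<N. bits.prob {x. x \<in> a k \<longleftrightarrow> flip (A n) x \<notin> a k}) - 0) < e / 3"
      using LIMSEQ_D[OF lim, of "e/3"] e by fastforce
    show "\<exists>no. \<forall>n\<ge>no. norm (bits.prob {x. x \<in> \<Union> (range a) \<longleftrightarrow> flip (A n) x \<notin> \<Union> (range a)} - 0) < e"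
    proof (intro exI allI impI)
      fix n assume n: "n \<ge> n0"
      let ?D = "\<lambda>k. {x. x \<in> a k \<longleftrightarrow> flip (A n) x \<notin> a k}" and ?R = "(\<Union>k. a k) - U N"
      have Deq: "?D k = (a k - flip (A n) -` a k) \<union> (flip (A n) -` a k - a k)" for k by auto
      have D: "?D k \<in> sets bit_space" for k unfolding Deq by (intro sets.Un sets.Diff sets_flip a_sets)
      have R: "?R \<in> sets bit_space" by measurable
      \<comment> \<open>A point whose membership in the union changes either changes membership in
        one of the first \<open>N\<close> sets, or it or its flip lies in the remainder
        \<open>?R\<close>.\<close>
      have "bits.prob {x. x \<in> \<Union> (range a) \<longleftrightarrow> flip (A n) x \<notin> \<Union> (range a)}
        \<le> bits.prob ((\<Union>k\<in>{..<N}. ?D k) \<union> (?R \<union> flip (A n) -` ?R))"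
        by (rule bits.finite_measure_mono) (auto simp: U_def intro!: sets.Un sets.finite_UN D R sets_flip)
      also have "\<dots> \<le> bits.prob (\<Union>k\<in>{..<N}. ?D k) + bits.prob (?R \<union> flip (A n) -` ?R)"
        by (rule measure_Un_le) (auto intro!: sets.Un sets.finite_UN D R sets_flip)
      also have "bits.prob (\<Union>k\<in>{..<N}. ?D k) \<le> (\<Sum>k<N. bits.prob (?D k))"
        by (rule measure_UNION_le) (auto intro: D)
      also have "bits.prob (?R \<union> flip (A n) -` ?R) \<le> bits.prob ?R + bits.prob (flip (A n) -` ?R)"
        by (rule measure_Un_le) (auto intro!: R sets_flip)
      also have "bits.prob (flip (A n) -` ?R) = bits.prob ?R"
        by (rule prob_flip[OF R])
      finally show "norm (bits.prob {x. x \<in> \<Union> (range a) \<longleftrightarrow> flip (A n) x \<notin> \<Union> (range a)} - 0) < e"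
        using n0[OF n] small by simp
    qed
  qed
next
  case (Compl a)
  have "{x. x \<in> UNIV - a \<longleftrightarrow> flip (A n) x \<notin> UNIV - a} = {x. x \<in> a \<longleftrightarrow> flip (A n) x \<notin> a}" for n
    by auto
  then show ?case using Compl.IH by simp
qed simp


text \<open>Two values more than \<open>e\<close> apart are separated by a multiple of
  \<open>e\<close>. This reduces the claim to the sublevel sets \<open>S q\<close>, of which
  finitely many suffice once the small set where \<open>g\<close> is large is discarded.\<close>

lemma flip_tendsto_in_measure:
  fixes A :: "nat \<Rightarrow> 'i set" and g :: "('i \<Rightarrow> bool) \<Rightarrow> real"
  assumes A: "vanishing A" and g [measurable]: "g \<in> borel_measurable bit_space" and e: "e > 0"
  shows "(\<lambda>n. bits.prob {x. \<bar>g (flip (A n) x) - g x\<bar> > e}) \<longlonglongrightarrow> 0"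
proof (rule LIMSEQ_I)
  fix r :: real assume r: "r > 0"
  define B where "B m = {x. \<bar>g x\<bar> > real m}" for m
  have B [measurable]: "B m \<in> sets bit_space" for m
  proof -
    have "{x \<in> space bit_space. \<bar>g x\<bar> > real m} \<in> sets bit_space" by measurable
    then show ?thesis by (simp add: B_def)
  qed
  have "(\<lambda>m. bits.prob (B m)) \<longlonglongrightarrow> bits.prob (\<Inter>m. B m)"
  proof (rule bits.finite_Lim_measure_decseq)
    show "range B \<subseteq> bits.events" using B by auto
    show "decseq B" by (auto simp: B_def decseq_def)
  qed
  moreover have "(\<Inter>m. B m) = {}"
    unfolding B_def by (auto, metis less_asym reals_Archimedean2)
  ultimately have "(\<lambda>m. bits.prob (B m)) \<longlonglongrightarrow> 0" by simp
  then obtain m where m: "norm (bits.prob (B m) - 0) < r / 2"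
    using LIMSEQ_D[of _ _ "r/2"] r by (metis half_gt_zero order_refl)
  \<comment> \<open>The extra \<open>1\<close> brings both grid indices around \<open>g x\<close>,
    namely \<open>q\<close> and \<open>q + 1\<close>, into the range whenever
    \<open>\<bar>g x\<bar> \<le> m\<close>.\<close>
  define L :: int where "L = \<lceil>real m / e\<rceil> + 1"
  define S where "S q = {x. g x < real_of_int q * e}" for q
  have S: "S q \<in> sets bit_space" for q
  proof -
    have "{x \<in> space bit_space. g x < real_of_int q * e} \<in> sets bit_space" by measurable
    then show ?thesis by (simp add: S_def)
  qed
  let ?D = "\<lambda>n q. {x. x \<in> S q \<longleftrightarrow> flip (A n) x \<notin> S q}"
  have Deq: "?D n q = (S q - flip (A n) -` S q) \<union> (flip (A n) -` S q - S q)" for n q by auto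
  have D: "?D n q \<in> sets bit_space" for n q
    unfolding Deq by (intro sets.Un sets.Diff sets_flip S)
  have sub: "{x. \<bar>g (flip (A n) x) - g x\<bar> > e} \<subseteq> B m \<union> (\<Union>q\<in>{-L..L}. ?D n q)" for n
  proof
    fix x assume x: "x \<in> {x. \<bar>g (flip (A n) x) - g x\<bar> > e}"
    show "x \<in> B m \<union> (\<Union>q\<in>{-L..L}. ?D n q)"
    proof (cases "\<bar>g x\<bar> > real m")
      case False
      define q where "q = \<lfloor>g x / e\<rfloor>"
      have q: "real_of_int q * e \<le> g x" "g x < (real_of_int q + 1) * e"
        using e floor_divide_lower[of e "g x"] floor_divide_upper[of e "g x"] by (simp_all add: q_def)
      have mL: "real m \<le> real_of_int (L - 1) * e"
      proof -
        have "real m / e * e \<le> real_of_int (L - 1) * e"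
          unfolding L_def by (rule mult_right_mono) (use e in auto)
        then show ?thesis using e by simp
      qed
      have "- (real_of_int (L - 1) * e) \<le> g x" "g x \<le> real_of_int (L - 1) * e"
        using False mL by linarith+
      then have "- real_of_int (L - 1) * e \<le> g x" "g x \<le> real_of_int (L - 1) * e"
        by (simp_all only: minus_mult_left)
      then have "- real_of_int (L - 1) * e < (real_of_int q + 1) * e" "real_of_int q * e \<le> real_of_int (L - 1) * e"
        using q by linarith+
      then have "- real_of_int (L - 1) < real_of_int q + 1" "real_of_int q \<le> real_of_int (L - 1)"
        using e by (simp_all only: mult_less_cancel_right_pos mult_le_cancel_right_pos)
      then have qL: "q \<in> {-L..L}" "q + 1 \<in> {-L..L}" by auto
      show ?thesis
      proof (cases "g (flip (A n) x) > g x")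
        case True
        then have "g (flip (A n) x) \<ge> real_of_int (q + 1) * e"
          using x q by (simp add: algebra_simps)
        then have "x \<in> ?D n (q + 1)"
          using q by (simp add: S_def algebra_simps)
        then show ?thesis using qL by blast
      next
        case False
        then have "g (flip (A n) x) < real_of_int q * e"
          using x q by (simp add: algebra_simps)
        then have "x \<in> ?D n q"
          using q by (simp add: S_def algebra_simps)
        then show ?thesis using qL by blast
      qed
    qed (simp add: B_def)
  qed
  have lim: "(\<lambda>n. \<Sum>q\<in>{-L..L}. bits.prob (?D n q)) \<longlonglongrightarrow> 0"
    using tendsto_sum[of "{-L..L}", OF flip_set_tendsto[OF A S]] by simp
  then obtain n0 where n0: "\<And>n. n \<ge> n0 \<Longrightarrow> norm ((\<Sum>q\<in>{-L..L}. bits.prob (?D n q)) - 0) < r / 2"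
    using LIMSEQ_D[OF lim, of "r/2"] r by fastforce
  show "\<exists>no. \<forall>n\<ge>no. norm (bits.prob {x. \<bar>g (flip (A n) x) - g x\<bar> > e} - 0) < r"
  proof (intro exI allI impI)
    fix n assume n: "n \<ge> n0"
    have "bits.prob {x. \<bar>g (flip (A n) x) - g x\<bar> > e} \<le> bits.prob (B m \<union> (\<Union>q\<in>{-L..L}. ?D n q))"
      by (rule bits.finite_measure_mono[OF sub]) (intro sets.Un sets.finite_UN D B, simp)
    also have "\<dots> \<le> bits.prob (B m) + bits.prob (\<Union>q\<in>{-L..L}. ?D n q)"
      by (rule measure_Un_le) (auto intro!: sets.finite_UN D)
    also have "bits.prob (\<Union>q\<in>{-L..L}. ?D n q) \<le> (\<Sum>q\<in>{-L..L}. bits.prob (?D n q))"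
      by (rule measure_UNION_le) (auto intro: D)
    finally show "norm (bits.prob {x. \<bar>g (flip (A n) x) - g x\<bar> > e} - 0) < r"
      using n0[OF n] m by simp
  qed
qed

lemma sets_bit_space_Collect:
  assumes "Measurable.pred bit_space P"
  shows "{x. P x} \<in> sets bit_space"
  using assms by (simp add: pred_def)

text \<open>
  Resetting the coordinates in \<open>R\<close> gives a reference point that is not changed by the flips, and
  the tails of the distances to it tend to \<open>0\<close> in measure. This makes the tails of the sum small
  uniformly in \<open>j\<close>.
\<close>

lemma flip_l1_tendsto_in_measure:
  fixes A :: "nat \<Rightarrow> 'i set" and h :: "nat \<Rightarrow> ('i \<Rightarrow> bool) \<Rightarrow> real"
  assumes A: "vanishing A" "\<And>j. A j \<subseteq> R" and h [measurable]: "\<And>k. h k \<in> borel_measurable bit_space"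
    and fin: "\<And>x y. (\<And>i. i \<notin> R \<Longrightarrow> x i = y i) \<Longrightarrow> summable (\<lambda>k. \<bar>h k x - h k y\<bar>)"
    and e: "e > 0"
  shows "(\<lambda>j. bits.prob {x. (\<Sum>k. \<bar>h k (flip (A j) x) - h k x\<bar>) > e}) \<longlonglongrightarrow> 0"
proof (rule LIMSEQ_I)
  fix r :: real assume r: "r > 0"
  define reset where "reset x = (\<lambda>i. i \<notin> R \<and> x i)" for x :: "'i \<Rightarrow> bool"
  have [measurable]: "reset \<in> bit_space \<rightarrow>\<^sub>M bit_space"
    by (rule measurable_into_bit_space) (simp add: reset_def)
  have reset_flip: "reset (flip (A j) x) = reset x" for j x
    using A(2)[of j] by (auto simp: reset_def flip_def fun_eq_iff)
  have sm: "summable (\<lambda>k. \<bar>h k x - h k (reset x)\<bar>)" for x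
    by (rule fin) (simp add: reset_def)
  define T where "T K x = (\<Sum>k. \<bar>h (k + K) x - h (k + K) (reset x)\<bar>)" for K x
  have [measurable]: "T K \<in> borel_measurable bit_space" for K
    unfolding T_def by measurable
  have T_eq: "T K x = (\<Sum>k. \<bar>h k x - h k (reset x)\<bar>) - (\<Sum>k<K. \<bar>h k x - h k (reset x)\<bar>)" for K x
    unfolding T_def by (rule suminf_minus_initial_segment[OF sm])
  have T_lim: "(\<lambda>K. T K x) \<longlonglongrightarrow> 0" for x
    unfolding T_eq using tendsto_diff[OF tendsto_const summable_LIMSEQ[OF sm[of x]], of "\<Sum>k. \<bar>h k x - h k (reset x)\<bar>"] by simp
  define B where "B K = {x. T K x > e / 4}" for K
  have B: "B K \<in> sets bit_space" for K
    unfolding B_def by (rule sets_bit_space_Collect) measurable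
  have "(\<lambda>K. bits.prob (B K)) \<longlonglongrightarrow> bits.prob (\<Inter>K. B K)"
  proof (rule bits.finite_Lim_measure_decseq)
    show "range B \<subseteq> bits.events" using B by auto
    have "T (Suc K) x \<le> T K x" for K x by (simp add: T_eq)
    then show "decseq B"
      by (intro decseq_SucI) (auto simp: B_def intro: less_le_trans)
  qed
  moreover have "(\<Inter>K. B K) = {}"
  proof -
    have "\<exists>K. T K x < e / 4" for x
      using order_tendstoD(2)[OF T_lim, of "e/4" x] e by (auto simp: eventually_sequentially)
    then have "\<exists>K. x \<notin> B K" for x
      unfolding B_def by (metis less_asym mem_Collect_eq)
    then show ?thesis by blast
  qed
  ultimately have "(\<lambda>K. bits.prob (B K)) \<longlonglongrightarrow> 0" by simp
  then obtain K where K: "norm (bits.prob (B K) - 0) < r / 4"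
    using LIMSEQ_D[of _ _ "r/4"] r by (metis order_refl divide_pos_pos zero_less_numeral)
  \<comment> \<open>The first \<open>K\<close> terms then cost at most \<open>e / 4\<close> in all,
    and the tails of the two distances to the reference point cost at most \<open>e / 4\<close>
    each.\<close>
  define d where "d = e / (4 * (real K + 1))"
  have d: "d > 0" using e by (simp add: d_def)
  define D where "D j k = {x. \<bar>h k (flip (A j) x) - h k x\<bar> > d}" for j k
  have D: "D j k \<in> sets bit_space" for j k
    unfolding D_def by (rule sets_bit_space_Collect) measurable
  have sub: "{x. (\<Sum>k. \<bar>h k (flip (A j) x) - h k x\<bar>) > e} \<subseteq> (\<Union>k\<in>{..<K}. D j k) \<union> (B K \<union> flip (A j) -` B K)" for j
  proof (rule subsetI, rule ccontr)
    fix x assume x: "x \<in> {x. (\<Sum>k. \<bar>h k (flip (A j) x) - h k x\<bar>) > e}"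
    assume "x \<notin> (\<Union>k\<in>{..<K}. D j k) \<union> (B K \<union> flip (A j) -` B K)"
    then have 1: "\<And>k. k < K \<Longrightarrow> \<bar>h k (flip (A j) x) - h k x\<bar> \<le> d"
      and 2: "T K x \<le> e / 4" "T K (flip (A j) x) \<le> e / 4"
      by (auto simp: D_def B_def not_less)
    have sf: "summable (\<lambda>k. \<bar>h k (flip (A j) x) - h k x\<bar>)"
      by (rule fin) (use A(2)[of j] in \<open>auto simp: flip_def\<close>)
    have sT: "summable (\<lambda>k. \<bar>h (k + K) x - h (k + K) (reset x)\<bar>)" for x
      using sm[of x] by (subst summable_iff_shift)
    have "(\<Sum>k. \<bar>h (k + K) (flip (A j) x) - h (k + K) x\<bar>)
       \<le> (\<Sum>k. \<bar>h (k + K) (flip (A j) x) - h (k + K) (reset x)\<bar> + \<bar>h (k + K) x - h (k + K) (reset x)\<bar>)"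
    proof (rule suminf_le)
      show "summable (\<lambda>k. \<bar>h (k + K) (flip (A j) x) - h (k + K) x\<bar>)"
        using sf by (subst summable_iff_shift)
      show "summable (\<lambda>k. \<bar>h (k + K) (flip (A j) x) - h (k + K) (reset x)\<bar> + \<bar>h (k + K) x - h (k + K) (reset x)\<bar>)"
        using sT[of x] sT[of "flip (A j) x"] by (simp add: reset_flip summable_add)
    qed simp
    also have "\<dots> = T K (flip (A j) x) + T K x"
      unfolding T_def using sT[of x] sT[of "flip (A j) x"] by (simp add: reset_flip suminf_add)
    finally have "(\<Sum>k. \<bar>h (k + K) (flip (A j) x) - h (k + K) x\<bar>) \<le> e / 2"
      using 2 by simp
    moreover have "(\<Sum>k<K. \<bar>h k (flip (A j) x) - h k x\<bar>) \<le> (\<Sum>k<K. d)"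
      by (rule sum_mono) (use 1 in simp)
    moreover have "(\<Sum>k<K. d) \<le> e / 4"
      using e by (simp add: d_def field_simps)
    moreover have "(\<Sum>k. \<bar>h k (flip (A j) x) - h k x\<bar>)
      = (\<Sum>k. \<bar>h (k + K) (flip (A j) x) - h (k + K) x\<bar>) + (\<Sum>k<K. \<bar>h k (flip (A j) x) - h k x\<bar>)"
      by (rule suminf_split_initial_segment[OF sf])
    ultimately show False using x e by simp
  qed
  have lim: "(\<lambda>j. \<Sum>k<K. bits.prob (D j k)) \<longlonglongrightarrow> 0"
    using tendsto_sum[of "{..<K}", OF flip_tendsto_in_measure[OF A(1) h d]] by (simp add: D_def)
  then obtain n0 where n0: "\<And>j. j \<ge> n0 \<Longrightarrow> norm ((\<Sum>k<K. bits.prob (D j k)) - 0) < r / 2"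
    using LIMSEQ_D[OF lim, of "r/2"] r by fastforce
  show "\<exists>no. \<forall>j\<ge>no. norm (bits.prob {x. (\<Sum>k. \<bar>h k (flip (A j) x) - h k x\<bar>) > e} - 0) < r"
  proof (intro exI allI impI)
    fix j assume j: "j \<ge> n0"
    have "bits.prob {x. (\<Sum>k. \<bar>h k (flip (A j) x) - h k x\<bar>) > e} \<le> bits.prob ((\<Union>k\<in>{..<K}. D j k) \<union> (B K \<union> flip (A j) -` B K))"
      by (rule bits.finite_measure_mono[OF sub]) (intro sets.Un sets.finite_UN D B sets_flip, simp)
    also have "\<dots> \<le> bits.prob (\<Union>k\<in>{..<K}. D j k) + bits.prob (B K \<union> flip (A j) -` B K)"
      by (rule measure_Un_le) (auto intro!: sets.Un sets.finite_UN D B sets_flip)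
    also have "bits.prob (\<Union>k\<in>{..<K}. D j k) \<le> (\<Sum>k<K. bits.prob (D j k))"
      by (rule measure_UNION_le) (auto intro: D)
    also have "bits.prob (B K \<union> flip (A j) -` B K) \<le> bits.prob (B K) + bits.prob (flip (A j) -` B K)"
      by (rule measure_Un_le) (intro B sets_flip)+
    also have "bits.prob (flip (A j) -` B K) = bits.prob (B K)"
      by (rule prob_flip[OF B])
    finally show "norm (bits.prob {x. (\<Sum>k. \<bar>h k (flip (A j) x) - h k x\<bar>) > e} - 0) < r"
      using n0[OF j] K by simp
  qed
qed

section \<open>Flipping one bit in every row of a random matrix\<close>

lemma flip_flip: "A \<inter> B = {} \<Longrightarrow> flip A (flip B x) = flip (A \<union> B) x"
  by (auto simp: flip_def fun_eq_iff)

lemma AE_eventually_notin: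
  assumes "\<And>n. B n \<in> sets bit_space" "\<And>n. bits.prob (B n) < (1/2) ^ n"
  shows "AE x in bit_space. \<forall>\<^sub>F n in sequentially. x \<notin> B n"
proof -
  have "AE x in bit_space. \<forall>\<^sub>F n in sequentially. x \<in> space bit_space - B n"
  proof (rule borel_cantelli_AE1)
    have "summable (\<lambda>n. norm (bits.prob (B n)))"
      by (rule summable_comparison_test'[of "\<lambda>n. (1/2) ^ n" 0])
         (use assms(2) in \<open>auto simp: less_imp_le\<close>)
    then show "summable (\<lambda>n. bits.prob (B n))" by simp
  qed (use assms(1) bits.emeasure_finite in \<open>auto simp: less_top[symmetric]\<close>)
  then show ?thesis by simp
qed

text \<open>The bit of row \<open>n\<close> is taken so far out that, outside a set of measure below
  \<open>(1/2)^n\<close>, it moves the whole sequence \<open>h\<close> by at most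
  \<open>(1/2)^n\<close> in l1. As the \<open>h k\<close> are only measurable, this does not bound
  the effect of all flips together; a second estimate treats finitely many \<open>h k\<close> and a
  late tail of flips.\<close>

proposition exists_l1_close_flip:
  fixes h :: "nat \<Rightarrow> (nat \<times> nat \<Rightarrow> bool) \<Rightarrow> real"
  assumes h [measurable]: "\<And>k. h k \<in> borel_measurable bit_space"
    and fin: "\<And>n x y. (\<And>i. fst i \<noteq> n \<Longrightarrow> x i = y i) \<Longrightarrow> summable (\<lambda>k. \<bar>h k x - h k y\<bar>)"
  obtains J x where "summable (\<lambda>k. \<bar>h k (flip (range (\<lambda>n. (n, J n))) x) - h k x\<bar>)"
proof -
  define D where "D n j x = (\<Sum>k. \<bar>h k (flip {(n, j)} x) - h k x\<bar>)" for n j x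
  have [measurable]: "D n j \<in> borel_measurable bit_space" for n j
    unfolding D_def by measurable
  have "\<exists>j. bits.prob {x. D n j x > (1/2) ^ n} < (1/2) ^ n" for n
  proof -
    have "(\<lambda>j. bits.prob {x. D n j x > (1/2) ^ n}) \<longlonglongrightarrow> 0"
      unfolding D_def
    proof (rule flip_l1_tendsto_in_measure[where R = "{n} \<times> UNIV"])
      show "vanishing (\<lambda>j. {(n, j)})"
        unfolding vanishing_def
      proof
        fix i :: "nat \<times> nat"
        show "\<forall>\<^sub>F j in sequentially. i \<notin> {(n, j)}"
          using eventually_gt_at_top[of "snd i"] by eventually_elim auto
      qed
      show "summable (\<lambda>k. \<bar>h k x - h k y\<bar>)" if "\<And>i. i \<notin> {n} \<times> UNIV \<Longrightarrow> x i = y i" for x y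
        by (rule fin[of n]) (use that in force)
    qed auto
    then have "\<forall>\<^sub>F j in sequentially. bits.prob {x. D n j x > (1/2) ^ n} < (1/2) ^ n"
      by (rule order_tendstoD) simp
    then show ?thesis by (auto simp: eventually_sequentially)
  qed
  then obtain J where J: "\<And>n. bits.prob {x. D n (J n) x > (1/2) ^ n} < (1/2) ^ n" by metis
  define S where "S n = flip ((\<lambda>m. (m, J m)) ` {..<n})" for n
  define T where "T n = (\<lambda>m. (m, J m)) ` {n..}" for n
  have S_Suc: "S (Suc n) x = flip {(n, J n)} (S n x)" for n x
    unfolding S_def by (subst flip_flip) (auto simp: lessThan_Suc)
  have S_T: "flip (range (\<lambda>n. (n, J n))) x = flip (T n) (S n x)" for n x
    unfolding S_def T_def
    by (subst flip_flip) (auto simp: image_Un[symmetric] intro!: arg_cong[where f = "\<lambda>A. flip A x"] arg_cong[where f = "image _"])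
  \<comment> \<open>The next flip is applied at \<open>S n x\<close>, so its bad set is pulled back
    along \<open>S n\<close>, which preserves the measure.\<close>
  define B1 where "B1 n = S n -` {x. D n (J n) x > (1/2) ^ n}" for n
  have B1: "B1 n \<in> sets bit_space" "bits.prob (B1 n) < (1/2) ^ n" for n
  proof -
    have *: "{x. D n (J n) x > (1/2) ^ n} \<in> sets bit_space"
      by (rule sets_bit_space_Collect) measurable
    show "B1 n \<in> sets bit_space"
      unfolding B1_def S_def by (rule sets_flip[OF *])
    show "bits.prob (B1 n) < (1/2) ^ n"
      using J[of n] prob_flip[OF *] by (simp add: B1_def S_def)
  qed
  \<comment> \<open>With tolerance \<open>1 / (K + 1)\<close> the first \<open>K\<close> terms
    contribute at most \<open>1\<close> together.\<close>
  define F where "F K n = (\<Union>k\<in>{..<K}. {x. \<bar>h k (flip (T n) x) - h k x\<bar> > 1 / (real K + 1)})" for K n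
  have F: "F K n \<in> sets bit_space" for K n
    unfolding F_def by (rule sets.finite_UN, simp, rule sets_bit_space_Collect) measurable
  have "\<exists>n. bits.prob (F K n) < (1/2) ^ K" for K
  proof -
    have "vanishing T"
      unfolding vanishing_def
    proof
      fix i :: "nat \<times> nat"
      show "\<forall>\<^sub>F n in sequentially. i \<notin> T n"
        using eventually_gt_at_top[of "fst i"] by eventually_elim (auto simp: T_def)
    qed
    from flip_tendsto_in_measure[OF this h, of "1 / (real K + 1)"]
    have "(\<lambda>n. \<Sum>k<K. bits.prob {x. \<bar>h k (flip (T n) x) - h k x\<bar> > 1 / (real K + 1)}) \<longlonglongrightarrow> (\<Sum>k<K. 0)"
      by (intro tendsto_sum) simp
    then have "\<forall>\<^sub>F n in sequentially. (\<Sum>k<K. bits.prob {x. \<bar>h k (flip (T n) x) - h k x\<bar> > 1 / (real K + 1)}) < (1/2) ^ K"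
      by (rule order_tendstoD) simp
    then obtain n where "(\<Sum>k<K. bits.prob {x. \<bar>h k (flip (T n) x) - h k x\<bar> > 1 / (real K + 1)}) < (1/2) ^ K"
      by (auto simp: eventually_sequentially)
    moreover have "bits.prob (F K n) \<le> (\<Sum>k<K. bits.prob {x. \<bar>h k (flip (T n) x) - h k x\<bar> > 1 / (real K + 1)})"
      unfolding F_def by (rule measure_UNION_le, simp, rule sets_bit_space_Collect) measurable
    ultimately show ?thesis by (intro exI[of _ n]) simp
  qed
  then obtain N where N: "\<And>K. bits.prob (F K (N K)) < (1/2) ^ K" by metis
  define B2 where "B2 K = S (N K) -` F K (N K)" for K
  have B2: "B2 K \<in> sets bit_space" "bits.prob (B2 K) < (1/2) ^ K" for K
    using N[of K] sets_flip[OF F] prob_flip[OF F] by (simp_all add: B2_def S_def)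
  have "AE x in bit_space. (\<forall>\<^sub>F n in sequentially. x \<notin> B1 n) \<and> (\<forall>\<^sub>F n in sequentially. x \<notin> B2 n)"
    using AE_eventually_notin[OF B1] AE_eventually_notin[OF B2] by eventually_elim simp
  then have "\<exists>x. (\<forall>\<^sub>F n in sequentially. x \<notin> B1 n) \<and> (\<forall>\<^sub>F n in sequentially. x \<notin> B2 n)"
    using bits.AE_contr eventually_happens' bits.ae_filter_bot by blast
  then obtain x where x: "\<forall>\<^sub>F n in sequentially. x \<notin> B1 n" "\<forall>\<^sub>F n in sequentially. x \<notin> B2 n" by blast
  define E where "E n = D n (J n) (S n x)" for n
  have E_sm: "summable (\<lambda>k. \<bar>h k (S (Suc n) x) - h k (S n x)\<bar>)" for n
    by (rule fin[of n]) (auto simp: S_Suc flip_def)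
  have E_eq: "E n = (\<Sum>k. \<bar>h k (S (Suc n) x) - h k (S n x)\<bar>)" for n
    by (simp add: E_def D_def S_Suc)
  have E_nn: "E n \<ge> 0" for n unfolding E_eq by (rule suminf_nonneg[OF E_sm]) simp
  have "\<forall>\<^sub>F n in sequentially. norm (E n) \<le> (1/2) ^ n"
    using x(1) by eventually_elim (use E_nn in \<open>simp add: B1_def E_def\<close>)
  then have E: "summable E"
    by (rule summable_comparison_test_ev) simp
  have step: "(\<Sum>k<K. \<bar>h k (S n x) - h k x\<bar>) \<le> (\<Sum>m<n. E m)" for K n
  proof (induction n)
    case 0
    then show ?case by (simp add: S_def flip_def)
  next
    case (Suc n)
    have "(\<Sum>k<K. \<bar>h k (S (Suc n) x) - h k x\<bar>) \<le> (\<Sum>k<K. \<bar>h k (S n x) - h k x\<bar> + \<bar>h k (S (Suc n) x) - h k (S n x)\<bar>)"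
      by (rule sum_mono) simp
    also have "\<dots> = (\<Sum>k<K. \<bar>h k (S n x) - h k x\<bar>) + (\<Sum>k<K. \<bar>h k (S (Suc n) x) - h k (S n x)\<bar>)"
      by (rule sum.distrib)
    also have "(\<Sum>k<K. \<bar>h k (S (Suc n) x) - h k (S n x)\<bar>) \<le> E n"
      unfolding E_eq by (rule sum_le_suminf[OF E_sm]) auto
    finally show ?case using Suc by simp
  qed
  let ?y = "flip (range (\<lambda>n. (n, J n))) x"
  obtain K0 where K0: "\<And>K. K \<ge> K0 \<Longrightarrow> x \<notin> B2 K"
    using x(2) by (auto simp: eventually_sequentially)
  \<comment> \<open>The flips are split at row \<open>N K\<close>: those before it cost at most the
    sum of the single steps, the others at most \<open>1\<close>. Neither bound depends on
    \<open>K\<close>.\<close>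
  have bound: "(\<Sum>k<K. \<bar>h k ?y - h k x\<bar>) \<le> 1 + suminf E" if K: "K \<ge> K0" for K
  proof -
    let ?n = "N K"
    have "\<bar>h k ?y - h k (S ?n x)\<bar> \<le> 1 / (real K + 1)" if "k < K" for k
      using K0[OF K] that by (auto simp: B2_def F_def S_T[of _ ?n] not_less)
    then have "(\<Sum>k<K. \<bar>h k ?y - h k (S ?n x)\<bar>) \<le> (\<Sum>k<K. 1 / (real K + 1))"
      by (intro sum_mono) simp
    also have "\<dots> \<le> 1" by (simp add: field_simps)
    finally have 1: "(\<Sum>k<K. \<bar>h k ?y - h k (S ?n x)\<bar>) \<le> 1" .
    have "(\<Sum>k<K. \<bar>h k ?y - h k x\<bar>) \<le> (\<Sum>k<K. \<bar>h k ?y - h k (S ?n x)\<bar> + \<bar>h k (S ?n x) - h k x\<bar>)"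
      by (rule sum_mono) simp
    also have "\<dots> = (\<Sum>k<K. \<bar>h k ?y - h k (S ?n x)\<bar>) + (\<Sum>k<K. \<bar>h k (S ?n x) - h k x\<bar>)"
      by (rule sum.distrib)
    also have "\<dots> \<le> 1 + (\<Sum>m<?n. E m)" using 1 step by (intro add_mono)
    also have "(\<Sum>m<?n. E m) \<le> suminf E"
      by (rule sum_le_suminf[OF E]) (use E_nn in auto)
    finally show ?thesis by simp
  qed
  have "summable (\<lambda>k. \<bar>h k ?y - h k x\<bar>)"
  proof (rule summableI_nonneg_bounded)
    fix K
    have "(\<Sum>k<K. \<bar>h k ?y - h k x\<bar>) \<le> (\<Sum>k<max K K0. \<bar>h k ?y - h k x\<bar>)"
      by (rule sum_mono2) auto
    also have "\<dots> \<le> 1 + suminf E" by (rule bound) simp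
    finally show "(\<Sum>k<K. \<bar>h k ?y - h k x\<bar>) \<le> 1 + suminf E" .
  qed simp
  then show ?thesis by (rule that)
qed

section \<open>Borel sets of Polish topologies\<close>

lemma space_borel_of [simp]: "space (borel_of X) = topspace X"
  unfolding borel_of_def by (rule space_measure_of) (auto dest: openin_subset)

lemma sets_borel_of: "sets (borel_of X) = sigma_sets (topspace X) {U. openin X U}"
  unfolding borel_of_def by (rule sets_measure_of) (auto dest: openin_subset)

lemma openin_borel_of: "openin X U \<Longrightarrow> U \<in> sets (borel_of X)"
  by (simp add: sets_borel_of)

lemma measurable_borel_ofI:
  assumes "f \<in> space N \<rightarrow> topspace Y" "\<And>U. openin Y U \<Longrightarrow> f -` U \<inter> space N \<in> sets N"
  shows "f \<in> N \<rightarrow>\<^sub>M borel_of Y"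
  unfolding borel_of_def
  by (rule measurable_measure_of) (use assms in \<open>auto dest: openin_subset\<close>)

lemma continuous_map_measurable:
  assumes "continuous_map X Y f"
  shows "f \<in> borel_of X \<rightarrow>\<^sub>M borel_of Y"
proof (rule measurable_borel_ofI)
  fix U assume "openin Y U"
  then have "openin X {x \<in> topspace X. f x \<in> U}"
    using assms by (rule openin_continuous_map_preimage[rotated])
  then have "{x \<in> topspace X. f x \<in> U} \<in> sets (borel_of X)"
    by (rule openin_borel_of)
  moreover have "f -` U \<inter> space (borel_of X) = {x \<in> topspace X. f x \<in> U}" by auto
  ultimately show "f -` U \<inter> space (borel_of X) \<in> sets (borel_of X)" by simp
qed (use continuous_map_image_subset_topspace[OF assms] in auto)

lemma borel_of_euclidean: "borel_of (euclidean :: 'a::topological_space topology) = borel"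
  by (simp add: borel_of_def borel_def)

lemma (in Metric_space) separable_imp_second_countable:
  assumes "separable_space mtopology"
  shows "second_countable mtopology"
proof -
  obtain C where C: "countable C" "C \<subseteq> M" "mtopology closure_of C = M"
    using assms by (auto simp: separable_space_def)
  define \<B> where "\<B> = (\<lambda>(c, n). mball c (inverse (real (Suc n)))) ` (C \<times> UNIV)"
  show ?thesis
    unfolding second_countable_def
  proof (intro exI[of _ \<B>] conjI allI impI)
    show "countable \<B>" using C by (simp add: \<B>_def)
    show "\<forall>V\<in>\<B>. openin mtopology V" by (auto simp: \<B>_def)
    fix U x assume U: "openin mtopology U \<and> x \<in> U"
    then obtain r where r: "r > 0" "mball x r \<subseteq> U" and x: "x \<in> M"
      using openin_mtopology by (metis subsetD)
    obtain n where n: "inverse (real (Suc n)) < r / 2"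
      using reals_Archimedean[of "r/2"] r by auto
    have "x \<in> mtopology closure_of C" using x C by simp
    then obtain c where c: "c \<in> C" "d x c < inverse (real (Suc n))"
      unfolding metric_closure_of by (auto dest!: spec[of _ "inverse (real (Suc n))"])
    have cM: "c \<in> M" using c C by auto
    have "mball c (inverse (real (Suc n))) \<subseteq> mball x r"
    proof
      fix y assume y: "y \<in> mball c (inverse (real (Suc n)))"
      then have "d x y \<le> d x c + d c y" using x cM triangle by auto
      then show "y \<in> mball x r" using y x c n by auto
    qed
    then show "\<exists>V\<in>\<B>. x \<in> V \<and> V \<subseteq> U"
      using r c x cM by (intro bexI[of _ "mball c (inverse (real (Suc n)))"]) (auto simp: \<B>_def commute)
  qed
qed

lemma polish_second_countable: "polish_topology X \<Longrightarrow> second_countable X"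
  unfolding polish_topology_def completely_metrizable_space_def
  using Metric_space.separable_imp_second_countable by blast

text \<open>
  The preimage of an open set is reduced to countably many preimages of basic boxes, which is
  where second countability of the factors enters.
\<close>

lemma measurable_into_product_topology:
  fixes X :: "nat \<Rightarrow> 'a topology"
  assumes sc: "\<And>n. second_countable (X n)"
    and f: "\<And>n. (\<lambda>x. f x n) \<in> N \<rightarrow>\<^sub>M borel_of (X n)"
  shows "f \<in> N \<rightarrow>\<^sub>M borel_of (product_topology X UNIV)"
proof (rule measurable_borel_ofI)
  have fn: "f x n \<in> topspace (X n)" if "x \<in> space N" for x n
    using measurable_space[OF f that] by simp
  then show "f \<in> space N \<rightarrow> topspace (product_topology X UNIV)"
    by (auto simp: topspace_product_topology)
  have "\<forall>n. \<exists>b :: nat \<Rightarrow> 'a set. (\<forall>k. openin (X n) (b k)) \<and>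
     (\<forall>U x. openin (X n) U \<and> x \<in> U \<longrightarrow> (\<exists>k. x \<in> b k \<and> b k \<subseteq> U))"
  proof
    fix n
    obtain \<B> where B: "countable \<B>" "\<forall>V\<in>\<B>. openin (X n) V"
      "\<forall>U x. openin (X n) U \<and> x \<in> U \<longrightarrow> (\<exists>V\<in>\<B>. x \<in> V \<and> V \<subseteq> U)"
      using sc[of n] unfolding second_countable_def by blast
    define b where "b = from_nat_into (insert {} \<B>)"
    have "range b = insert {} \<B>"
      unfolding b_def by (rule range_from_nat_into) (use B in auto)
    then have "\<forall>k. b k \<in> insert {} \<B>" "\<forall>V\<in>\<B>. \<exists>k. b k = V"
      by (blast, metis insertI2 image_iff)
    then show "\<exists>b :: nat \<Rightarrow> 'a set. (\<forall>k. openin (X n) (b k)) \<and>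
     (\<forall>U x. openin (X n) U \<and> x \<in> U \<longrightarrow> (\<exists>k. x \<in> b k \<and> b k \<subseteq> U))"
      using B by (intro exI[of _ b]) (metis insertE openin_empty)
  qed
  then obtain b :: "nat \<Rightarrow> nat \<Rightarrow> 'a set" where b: "\<And>n k. openin (X n) (b n k)"
    "\<And>n U x. openin (X n) U \<Longrightarrow> x \<in> U \<Longrightarrow> \<exists>k. x \<in> b n k \<and> b n k \<subseteq> U"
    by metis
  define box where "box l = {x \<in> topspace (product_topology X UNIV). \<forall>(n, k) \<in> set l. x n \<in> b n k}"
    for l :: "(nat \<times> nat) list"
  fix U assume U: "openin (product_topology X UNIV) U"
  have box_U: "\<exists>l. x \<in> box l \<and> box l \<subseteq> U" if x: "x \<in> U" for x
  proof -
    obtain V where V: "finite {n. V n \<noteq> topspace (X n)}" "\<And>n. openin (X n) (V n)"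
      "x \<in> Pi\<^sub>E UNIV V" "Pi\<^sub>E UNIV V \<subseteq> U"
      using U x unfolding openin_product_topology_alt by force
    obtain ns where ns: "set ns = {n. V n \<noteq> topspace (X n)}"
      using finite_list[OF V(1)] by auto
    have "\<exists>k. x n \<in> b n k \<and> b n k \<subseteq> V n" for n
      by (rule b(2)) (use V in auto)
    then obtain k where k: "\<And>n. x n \<in> b n (k n)" "\<And>n. b n (k n) \<subseteq> V n" by metis
    have "x \<in> topspace (product_topology X UNIV)"
      using openin_subset[OF U] x by blast
    then have "x \<in> box (map (\<lambda>n. (n, k n)) ns)"
      using k by (auto simp: box_def)
    moreover have "box (map (\<lambda>n. (n, k n)) ns) \<subseteq> Pi\<^sub>E UNIV V"
    proof
      fix y assume y: "y \<in> box (map (\<lambda>n. (n, k n)) ns)"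
      have "y n \<in> V n" for n
      proof (cases "n \<in> set ns")
        case True
        then show ?thesis using y k(2)[of n] by (auto simp: box_def)
      next
        case False
        then have "V n = topspace (X n)" using ns by auto
        then show ?thesis using y by (auto simp: box_def topspace_product_topology)
      qed
      then show "y \<in> Pi\<^sub>E UNIV V" by auto
    qed
    ultimately show ?thesis using V(4) by blast
  qed
  have "U = (\<Union>l\<in>{l. box l \<subseteq> U}. box l)" using box_U by blast
  then have "f -` U \<inter> space N = (\<Union>l\<in>{l. box l \<subseteq> U}. f -` box l \<inter> space N)" by blast
  moreover have "f -` box l \<inter> space N \<in> sets N" for l
  proof -
    have "f -` box l \<inter> space N = {x \<in> space N. \<forall>p \<in> set l. f x (fst p) \<in> b (fst p) (snd p)}"
      using fn by (auto simp: box_def topspace_product_topology split_beta)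
    also have "\<dots> \<in> sets N"
    proof (rule sets.sets_Collect_finite_All)
      show "{x \<in> space N. f x (fst p) \<in> b (fst p) (snd p)} \<in> sets N" for p
        using measurable_sets[OF f[of "fst p"] openin_borel_of[OF b(1)[of "fst p" "snd p"]]]
        by (simp add: vimage_def Int_def conj_commute)
    qed simp_all
    finally show ?thesis .
  qed
  ultimately show "f -` U \<inter> space N \<in> sets N"
    by (simp only:) (rule sets.countable_UN', auto)
qed

section \<open>Suslin sets as projections of closed sets\<close>

text \<open>For Polish \<open>Z\<close> these are the analytic sets. Membership has a witness, a
  sequence of naturals, such that point and witness together satisfy a closed condition.\<close>

definition suslin :: "'a topology \<Rightarrow> 'a set \<Rightarrow> bool" where
  "suslin Z S \<longleftrightarrow> (\<exists>W. closedin (prod_topology Z (euclidean :: (nat \<Rightarrow> nat) topology)) W \<and> S = fst ` W)"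

lemma continuous_on_eval: "continuous_on S (\<lambda>f :: nat \<Rightarrow> nat. f i)"
  by (rule continuous_on_product_then_coordinatewise[OF continuous_on_id])

lemma continuous_map_prod_nat_fun:
  fixes g :: "(nat \<Rightarrow> nat) \<Rightarrow> (nat \<Rightarrow> nat)"
  assumes "continuous_on UNIV g"
  shows "continuous_map (prod_topology Z euclidean) (prod_topology Z euclidean) (\<lambda>p. (fst p, g (snd p)))"
proof -
  have "continuous_map (prod_topology Z euclidean) euclidean (g \<circ> snd)"
    by (rule continuous_map_compose[OF continuous_map_snd]) (use assms in simp)
  then show ?thesis by (simp add: continuous_map_pairedI continuous_map_fst o_def)
qed

lemma suslin_closed:
  assumes "closedin Z S"
  shows "suslin Z S"
  unfolding suslin_def
  by (rule exI[of _ "S \<times> UNIV"]) (use assms in \<open>auto simp: closedin_prod_Times_iff\<close>)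

text \<open>Entry \<open>0\<close> of the witness names a set containing the point and the shifted
  sequence is a witness for that set. Since \<open>entry 0 \<noteq> i\<close> is a clopen condition,
  the combined condition is an intersection of closed ones.\<close>

lemma suslin_Union:
  fixes S :: "nat \<Rightarrow> 'a set"
  assumes "\<And>i. suslin Z (S i)"
  shows "suslin Z (\<Union>i. S i)"
proof -
  let ?Y = "prod_topology Z (euclidean :: (nat \<Rightarrow> nat) topology)"
  obtain W where W: "\<And>i. closedin ?Y (W i)" "\<And>i. S i = fst ` W i"
    using assms unfolding suslin_def by metis
  define g :: "(nat \<Rightarrow> nat) \<Rightarrow> (nat \<Rightarrow> nat)" where "g f = (\<lambda>n. f (Suc n))" for f
  have cg: "continuous_on UNIV g"
    unfolding g_def by (rule continuous_on_coordinatewise_then_product, rule continuous_on_eval)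
  define W' where "W' = (\<Inter>i. {p \<in> topspace ?Y. snd p 0 \<in> - {i}} \<union> {p \<in> topspace ?Y. (fst p, g (snd p)) \<in> W i})"
  have "continuous_map ?Y euclidean ((\<lambda>f. f 0) \<circ> snd)"
    by (rule continuous_map_compose[OF continuous_map_snd]) (simp add: continuous_on_eval)
  then have c0: "continuous_map ?Y euclidean (\<lambda>p. snd p 0)"
    by (simp add: o_def)
  have "closedin ?Y W'"
    unfolding W'_def
  proof (intro closedin_INT closedin_Un)
    show "closedin ?Y {p \<in> topspace ?Y. snd p 0 \<in> - {i}}" for i
      by (rule closedin_continuous_map_preimage[OF c0]) (simp add: closed_closedin[symmetric] closed_def discrete_topology_class.open_discrete)
    show "closedin ?Y {p \<in> topspace ?Y. (fst p, g (snd p)) \<in> W i}" for i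
      by (rule closedin_continuous_map_preimage[OF continuous_map_prod_nat_fun[OF cg] W(1)])
  qed simp
  moreover have "(\<Union>i. S i) = fst ` W'"
  proof safe
    fix i x assume "x \<in> S i"
    then obtain f where f: "(x, f) \<in> W i" using W by auto
    then have "x \<in> topspace Z" using closedin_subset[OF W(1)[of i]] by auto
    moreover have "g (case_nat i f) = f" by (simp add: g_def)
    ultimately have "(x, case_nat i f) \<in> W'" using f by (auto simp: W'_def)
    then show "x \<in> fst ` W'" by force
  next
    fix x f assume "(x, f) \<in> W'"
    then have "(x, g f) \<in> W (f 0)" by (auto simp: W'_def)
    then show "fst (x, f) \<in> (\<Union>i. S i)" using W(2) by force
  qed
  ultimately show ?thesis unfolding suslin_def by blast
qed

text \<open>One sequence stores a witness for every \<open>i\<close>, interleaved by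
  \<open>prod_encode\<close>.\<close>

lemma suslin_Inter:
  fixes S :: "nat \<Rightarrow> 'a set"
  assumes "\<And>i. suslin Z (S i)"
  shows "suslin Z (\<Inter>i. S i)"
proof -
  let ?Y = "prod_topology Z (euclidean :: (nat \<Rightarrow> nat) topology)"
  obtain W where W: "\<And>i. closedin ?Y (W i)" "\<And>i. S i = fst ` W i"
    using assms unfolding suslin_def by metis
  define g :: "nat \<Rightarrow> (nat \<Rightarrow> nat) \<Rightarrow> (nat \<Rightarrow> nat)" where "g i f = (\<lambda>n. f (prod_encode (i, n)))" for i f
  have cg: "continuous_on UNIV (g i)" for i
    unfolding g_def by (rule continuous_on_coordinatewise_then_product, rule continuous_on_eval)
  define W' where "W' = (\<Inter>i. {p \<in> topspace ?Y. (fst p, g i (snd p)) \<in> W i})"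
  have "closedin ?Y W'"
    unfolding W'_def
  proof (intro closedin_INT)
    show "closedin ?Y {p \<in> topspace ?Y. (fst p, g i (snd p)) \<in> W i}" for i
      by (rule closedin_continuous_map_preimage[OF continuous_map_prod_nat_fun[OF cg] W(1)])
  qed simp
  moreover have "(\<Inter>i. S i) = fst ` W'"
  proof
    show "(\<Inter>i. S i) \<subseteq> fst ` W'"
    proof
      fix x assume "x \<in> (\<Inter>i. S i)"
      then have "\<forall>i. \<exists>f. (x, f) \<in> W i" using W(2) by force
      then obtain f where f: "\<And>i. (x, f i) \<in> W i" by metis
      then have "x \<in> topspace Z" using closedin_subset[OF W(1)[of 0]] by force
      moreover have "g i (\<lambda>m. case prod_decode m of (i, n) \<Rightarrow> f i n) = f i" for i by (simp add: g_def)
      ultimately have "(x, \<lambda>m. case prod_decode m of (i, n) \<Rightarrow> f i n) \<in> W'" using f by (auto simp: W'_def)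
      then show "x \<in> fst ` W'" by force
    qed
    show "fst ` W' \<subseteq> (\<Inter>i. S i)"
    proof safe
      fix x f i assume "(x, f) \<in> W'"
      then have "(x, g i f) \<in> W i" by (auto simp: W'_def)
      then show "fst (x, f) \<in> S i" using W(2) by force
    qed
  qed
  ultimately show ?thesis unfolding suslin_def by blast
qed

lemma suslin_open:
  assumes Z: "metrizable_space Z" "openin Z U"
  shows "suslin Z U"
proof -
  obtain C :: "nat \<Rightarrow> 'a set" where "\<And>n. closedin Z (C n)" "\<Union> (range C) = U"
    using open_imp_fsigma_in[OF Z] unfolding fsigma_in_ascending by blast
  then show ?thesis using suslin_Union[of Z C] suslin_closed by blast
qed

text \<open>Suslin sets are in general not closed under complements, so the induction carries the
  complement along. Metrizability makes open sets countable unions of closed ones.\<close>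

lemma suslin_borel:
  assumes Z: "metrizable_space Z" and S: "S \<in> sets (borel_of Z)"
  shows "suslin Z S"
proof -
  have "suslin Z S \<and> suslin Z (topspace Z - S)"
    using S unfolding sets_borel_of
  proof (induction S rule: sigma_sets.induct)
    case (Basic a)
    then show ?case using suslin_open[OF Z] suslin_closed by blast
  next
    case Empty
    then show ?case by (simp add: suslin_closed)
  next
    case (Compl a)
    have "{U. openin Z U} \<subseteq> Pow (topspace Z)" by (auto dest: openin_subset)
    from sigma_sets_into_sp[OF this Compl.hyps] show ?case
      using Compl.IH by (simp add: double_diff)
  next
    case (Union a)
    have "topspace Z - (\<Union>i. a i) = (\<Inter>i. topspace Z - a i)" by auto
    then show ?case using Union suslin_Union[of Z a] suslin_Inter[of Z "\<lambda>i. topspace Z - a i"] by simp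
  qed
  then show ?thesis ..
qed

section \<open>Uncountably many classes\<close>

text \<open>
  A configuration consists of a point for every finite binary word \<open>s\<close> and, for all words \<open>p\<close> and
  \<open>t\<close>, of a sequence witnessing that the points at \<open>p @ [False] @ t\<close> and \<open>p @ [True] @ t\<close> are
  inequivalent. Level \<open>n\<close> of the construction only looks at the words of length \<open>n\<close>.
\<close>

type_synonym 'a config = "(bool list \<Rightarrow> 'a) \<times> (bool list \<Rightarrow> bool list \<Rightarrow> nat \<Rightarrow> nat)"

text \<open>Keeps the part at words ending in \<open>t\<close> and strips that ending. New bits are
  added at the end of words, so a configuration of level \<open>n + length t\<close> contains one of
  level \<open>n\<close> for each such \<open>t\<close>.\<close>

definition append_config :: "bool list \<Rightarrow> 'a config \<Rightarrow> 'a config" where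
  "append_config t c = (\<lambda>s. fst c (s @ t), \<lambda>p u. snd c p (u @ t))"

text \<open>The two halves, told apart by the last bit, come from \<open>H\<close>. Pairs of words
  that differ in the new last bit get their witnesses here; pairs that differ in an earlier bit
  inherit them from the halves.\<close>

definition double :: "(('a \<times> 'a) \<times> (nat \<Rightarrow> nat)) set \<Rightarrow> nat \<Rightarrow> 'a config set \<Rightarrow> 'a config set" where
  "double W n H = {c. (\<forall>b. append_config [b] c \<in> H) \<and>
     (\<forall>p. length p = n \<longrightarrow> ((fst c (p @ [False]), fst c (p @ [True])), snd c p []) \<in> W)}"

definition avoids :: "('a \<times> 'a) set \<Rightarrow> nat \<Rightarrow> 'a set \<Rightarrow> 'a config \<Rightarrow> bool" where
  "avoids F n D h \<longleftrightarrow> (\<forall>s. length s = n \<longrightarrow> (\<forall>d\<in>D. (d, fst h s) \<notin> F))"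

text \<open>The sets that are not positive form a sigma-ideal: for such a set there is a countable
  \<open>D\<close> to which every member has some point of level \<open>n\<close> related.
  Positivity is the notion of largeness that survives countable partitions as well as
  doubling.\<close>

definition positive :: "('a \<times> 'a) set \<Rightarrow> nat \<Rightarrow> 'a config set \<Rightarrow> bool" where
  "positive F n H \<longleftrightarrow>
(\<forall>D. countable D \<longrightarrow> (\<exists>h\<in>H. avoids F n D h))"

lemma finite_bool_lists: "finite {s :: bool list. length s \<le> n}"
  using finite_lists_length_le[of "UNIV :: bool set" n] by simp

text \<open>If each piece had a countable \<open>D\<close> that none of its members avoids, the
  union of these sets would be avoided by no member of \<open>H\<close>.\<close>

lemma positive_split:
  fixes \<kappa> :: "'a config \<Rightarrow> 'k::countable"
  assumes "positive F n H"
  shows "\<exists>k. positive F n {h \<in> H. \<kappa> h = k}"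
proof (rule ccontr)
  assume "\<nexists>k. positive F n {h \<in> H. \<kappa> h = k}"
  then have not_pos: "\<not> positive F n {h \<in> H. \<kappa> h = k}" for k
    by simp
  have "\<exists>D. countable D \<and> (\<forall>h. h \<in> H \<longrightarrow> \<kappa> h = k \<longrightarrow> \<not> avoids F n D h)" for k
    using not_pos[of k] unfolding positive_def by auto
  then have "\<exists>D. \<forall>k. countable (D k) \<and> (\<forall>h. h \<in> H \<longrightarrow> \<kappa> h = k \<longrightarrow> \<not> avoids F n (D k) h)"
    by (intro choice allI)
  then obtain D where D: "\<And>k. countable (D k)" "\<And>k h. h \<in> H \<Longrightarrow> \<kappa> h = k \<Longrightarrow> \<not> avoids F n (D k) h"
    by auto
  have "countable (\<Union>k. D k)" using D(1) by auto
  then obtain h where h: "h \<in> H" "avoids F n (\<Union>k. D k) h"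
    using assms unfolding positive_def by blast
  then have "avoids F n (D (\<kappa> h)) h" unfolding avoids_def by blast
  then show False using D(2)[OF h(1)] by blast
qed

text \<open>
  Any \<open>h\<^sub>0\<close> avoiding \<open>D\<close> can be paired with any \<open>h\<^sub>1\<close> that avoids \<open>D\<close> and also the
  finitely many classes of the points of \<open>h\<^sub>0\<close>.
\<close>

lemma positive_double:
  assumes F: "equiv M F" and W: "M \<times> M - F = fst ` W"
    and H: "positive F n H" and HM: "\<And>h s. h \<in> H \<Longrightarrow> length s = n \<Longrightarrow> fst h s \<in> M"
  shows "positive F (Suc n) (double W n H)"
  unfolding positive_def
proof (intro allI impI)
  fix D :: "'a set" assume D: "countable D"
  obtain h0 where "h0 \<in> H" "avoids F n D h0"
    using H D unfolding positive_def by blast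
  then have h0: "h0 \<in> H" "\<And>s d. length s = n \<Longrightarrow> d \<in> D \<Longrightarrow> (d, fst h0 s) \<notin> F"
    unfolding avoids_def by blast+
  have "finite {s :: bool list. length s = n}"
    by (rule finite_subset[OF _ finite_bool_lists[of n]]) auto
  then have "countable (D \<union> fst h0 ` {s. length s = n})"
    using D by (simp add: countable_finite)
  then obtain h1 where "h1 \<in> H" "avoids F n (D \<union> fst h0 ` {s. length s = n}) h1"
    using H unfolding positive_def by blast
  then have h1: "h1 \<in> H" "\<And>s d. length s = n \<Longrightarrow> d \<in> D \<union> fst h0 ` {s. length s = n} \<Longrightarrow> (d, fst h1 s) \<notin> F"
    unfolding avoids_def by blast+
  have "\<forall>p. \<exists>w. length p = n \<longrightarrow> ((fst h0 p, fst h1 p), w) \<in> W"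
  proof
    fix p
    show "\<exists>w. length p = n \<longrightarrow> ((fst h0 p, fst h1 p), w) \<in> W"
    proof (cases "length p = n")
      case True
      then have "(fst h0 p, fst h1 p) \<in> M \<times> M - F"
        using HM h0(1) h1 by auto
      then show ?thesis unfolding W by force
    qed simp
  qed
  then obtain w where w: "\<And>p. length p = n \<Longrightarrow> ((fst h0 p, fst h1 p), w p) \<in> W" by metis
  define h where "h b = (if b then h1 else h0)" for b
  \<comment> \<open>The last bit selects the half, and the empty tail receives the new
    witnesses.\<close>
  define c :: "'a config" where
    "c = (\<lambda>s. fst (h (last s)) (butlast s), \<lambda>p t. if t = [] then w p else snd (h (last t)) p (butlast t))"
  have c: "append_config [b] c = h b" for b
    by (simp add: append_config_def c_def)
  show "\<exists>c\<in>double W n H. avoids F (Suc n) D c"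
    unfolding avoids_def
  proof (intro bexI[of _ c] allI impI ballI)
    fix s :: "bool list" and d assume "length s = Suc n" "d \<in> D"
    then show "(d, fst c s) \<notin> F"
      using h0(2)[of "butlast s" d] h1(2)[of "butlast s" d] by (simp add: c_def h_def)
  next
    show "c \<in> double W n H"
      unfolding double_def using h0(1) h1(1) w by (simp add: c) (simp add: c_def h_def)
  qed
qed

section \<open>Fusion of positive sets of configurations\<close>

context Metric_space
begin

text \<open>Thinness at all levels forces points and witnesses to converge. The bounds on
  \<open>p\<close>, \<open>t\<close> and \<open>j\<close> leave finitely many witness entries to be
  fixed, so thinning amounts to a countable partition.\<close>

definition thin :: "nat \<Rightarrow> 'a config set \<Rightarrow> bool" where
  "thin n H \<longleftrightarrow> (\<forall>c\<in>H. \<forall>c'\<in>H.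
     (\<forall>s. length s = n \<longrightarrow> d (fst c s) (fst c' s) \<le> (1/2) ^ n) \<and>
     (\<forall>p t j. length p \<le> n \<longrightarrow> length t \<le> n \<longrightarrow> j < n \<longrightarrow> snd c p t j = snd c' p t j))"

lemma thin_points: "thin n H \<Longrightarrow> c \<in> H \<Longrightarrow> c' \<in> H \<Longrightarrow> length s = n \<Longrightarrow> d (fst c s) (fst c' s) \<le> (1/2) ^ n"
  unfolding thin_def by blast

lemma thin_witnesses:
  "thin n H \<Longrightarrow> c \<in> H \<Longrightarrow> c' \<in> H \<Longrightarrow> length p \<le> n \<Longrightarrow> length t \<le> n \<Longrightarrow> j < n \<Longrightarrow> snd c p t j = snd c' p t j"
  unfolding thin_def by blast

lemma positive_thin:
  assumes sep: "separable_space mtopology" and H: "positive F n H"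
    and HM: "\<And>h s. h \<in> H \<Longrightarrow> length s = n \<Longrightarrow> fst h s \<in> M"
  obtains H' where "H' \<subseteq> H" "positive F n H'" "thin n H'"
proof -
  obtain C where C: "countable C" "C \<subseteq> M" "mtopology closure_of C = M"
    using sep by (auto simp: separable_space_def)
  have "\<exists>i. d x (from_nat_into C i) < (1/2) ^ n / 2" if x: "x \<in> M" for x
  proof -
    have "x \<in> mtopology closure_of C" using x C by simp
    then obtain c where c: "c \<in> C" "d x c < (1/2) ^ n / 2"
      unfolding metric_closure_of by (auto dest!: spec[of _ "(1/2) ^ n / 2"])
    then obtain i where "from_nat_into C i = c"
      using from_nat_into_surj[OF C(1)] by blast
    then show ?thesis using c by blast
  qed
  then obtain idx where idx: "\<And>x. x \<in> M \<Longrightarrow> d x (from_nat_into C (idx x)) < (1/2) ^ n / 2" by metis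
  obtain L :: "bool list list" where L: "set L = {s. length s \<le> n}"
    using finite_list[OF finite_bool_lists] by blast
  \<comment> \<open>A countable invariant: the indices of nearby points of the dense set, and the
    first \<open>n\<close> entries of the finitely many witnesses concerned.\<close>
  define \<kappa> where "\<kappa> h = (map (\<lambda>s. idx (fst h s)) L, map (\<lambda>q. map (snd h (fst q) (snd q)) [0..<n]) (List.product L L))"
    for h :: "'a config"
  obtain k where k: "positive F n {h \<in> H. \<kappa> h = k}"
    using positive_split[OF H] by blast
  have "thin n {h \<in> H. \<kappa> h = k}"
    unfolding thin_def
  proof (intro ballI conjI allI impI)
    fix c c' assume c: "c \<in> {h \<in> H. \<kappa> h = k}" "c' \<in> {h \<in> H. \<kappa> h = k}"
    then have eq: "\<kappa> c = \<kappa> c'" by simp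
    {
      fix s :: "bool list" assume s: "length s = n"
      then have "s \<in> set L" by (simp add: L)
      then have i: "idx (fst c s) = idx (fst c' s)"
        using eq by (auto simp: \<kappa>_def)
      have M: "fst c s \<in> M" "fst c' s \<in> M" using HM c s by auto
      then have ne: "C \<noteq> {}" using C by auto
      then have "from_nat_into C (idx (fst c s)) \<in> M"
        using from_nat_into[OF ne, of "idx (fst c s)"] C(2) by blast
      then show "d (fst c s) (fst c' s) \<le> (1/2) ^ n"
        using triangle'[of "fst c s" "from_nat_into C (idx (fst c s))" "fst c' s"] M
          idx[OF M(1)] idx[OF M(2)] i commute by (smt (verit) field_sum_of_halves)
    next
      fix p t :: "bool list" and j assume "length p \<le> n" "length t \<le> n" and j: "j < n"
      then have "(p, t) \<in> set (List.product L L)" by (simp add: L)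
      then have "map (snd c p t) [0..<n] = map (snd c' p t) [0..<n]"
        using eq unfolding \<kappa>_def prod.inject map_eq_conv[of _ "List.product L L"] by (metis fst_conv snd_conv)
      then show "snd c p t j = snd c' p t j" using j by simp
    }
  qed
  with k show ?thesis by (intro that[of "{h \<in> H. \<kappa> h = k}"]) auto
qed

text \<open>A fusion argument. The points at the initial segments of a branch converge, and so do
  the witnesses of inequivalence for two branches that differ in one bit; as \<open>W\<close> is
  closed, the limits are still witnessed to be inequivalent. The hypothesis \<open>unc\<close> says
  that there are uncountably many classes, which makes level \<open>0\<close> positive.\<close>

proposition continuous_one_bit_inequivalent:
  fixes W :: "(('a \<times> 'a) \<times> (nat \<Rightarrow> nat)) set"
  assumes complete: mcomplete and sep: "separable_space mtopology"
    and F: "equiv M F"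
    and W: "closedin (prod_topology (prod_topology mtopology mtopology) euclidean) W" "M \<times> M - F = fst ` W"
    and unc: "\<And>D. countable D \<Longrightarrow> \<exists>x\<in>M. \<forall>d\<in>D. (d, x) \<notin> F"
  obtains \<phi> :: "(nat \<Rightarrow> bool) \<Rightarrow> 'a" where
    "\<And>\<alpha>. \<phi> \<alpha> \<in> M"
    "\<And>n \<alpha> \<beta>. (\<And>i. i < n \<Longrightarrow> \<alpha> i = \<beta> i) \<Longrightarrow> d (\<phi> \<alpha>) (\<phi> \<beta>) \<le> 2 * (1/2) ^ n"
    "\<And>\<alpha> i. \<not> \<alpha> i \<Longrightarrow> (\<phi> \<alpha>, \<phi> (\<alpha>(i := True))) \<notin> F"
proof -
  define good where "good n H \<longleftrightarrow> positive F n H \<and> thin n H \<and> (\<forall>h\<in>H. \<forall>s. length s = n \<longrightarrow> fst h s \<in> M)" for n and H :: "'a config set"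
  have "\<exists>f. \<forall>n. good n (f n) \<and> f (Suc n) \<subseteq> double W n (f n)"
  proof (rule dependent_nat_choice)
    let ?H = "{h :: 'a config. fst h [] \<in> M}"
    have "positive F 0 ?H"
      unfolding positive_def
    proof (intro allI impI)
      fix D :: "'a set" assume "countable D"
      then obtain x where x: "x \<in> M" "\<forall>d\<in>D. (d, x) \<notin> F" using unc by blast
      then show "\<exists>h\<in>?H. avoids F 0 D h"
        unfolding avoids_def by (intro bexI[of _ "(\<lambda>_. x, undefined)"]) auto
    qed
    then obtain H' where "H' \<subseteq> ?H" "positive F 0 H'" "thin 0 H'"
      by (rule positive_thin[OF sep]) auto
    then show "\<exists>H. good 0 H" unfolding good_def by (intro exI[of _ H']) auto
  next
    fix H n assume H: "good n H"
    have M: "fst h s \<in> M" if h: "h \<in> double W n H" and s: "length s = Suc n" for h s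
    proof -
      have "append_config [last s] h \<in> H" using h by (simp add: double_def)
      moreover have "length (butlast s) = n" using s by simp
      ultimately have "fst (append_config [last s] h) (butlast s) \<in> M"
        using H unfolding good_def by blast
      moreover have "butlast s @ [last s] = s" using s by (intro append_butlast_last_id) auto
      ultimately show ?thesis by (simp add: append_config_def)
    qed
    have "positive F (Suc n) (double W n H)"
      by (rule positive_double[OF F W(2)]) (use H in \<open>auto simp: good_def\<close>)
    then obtain H' where "H' \<subseteq> double W n H" "positive F (Suc n) H'" "thin (Suc n) H'"
      by (rule positive_thin[OF sep]) (use M in auto)
    then show "\<exists>H'. good (Suc n) H' \<and> H' \<subseteq> double W n H"
      unfolding good_def using M by (intro exI[of _ H']) auto
  qed
  then obtain H where H: "\<And>n. positive F n (H n)" "\<And>n. thin n (H n)"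
    "\<And>n h s. h \<in> H n \<Longrightarrow> length s = n \<Longrightarrow> fst h s \<in> M" "\<And>n. H (Suc n) \<subseteq> double W n (H n)"
    unfolding good_def by blast
  \<comment> \<open>Stripping \<open>t\<close> undoes \<open>length t\<close> doublings. This makes
    the \<open>h n\<close> below comparable, although they are chosen independently of each
    other.\<close>
  have H_app: "append_config t c \<in> H n" if "c \<in> H (n + length t)" for t c n
    using that
  proof (induction t arbitrary: c rule: rev_induct)
    case Nil
    then show ?case by (simp add: append_config_def)
  next
    case (snoc b t)
    then have "append_config [b] c \<in> H (n + length t)"
      using H(4)[of "n + length t"] by (auto simp: double_def)
    from snoc.IH[OF this] show ?case by (simp add: append_config_def)
  qed
  \<comment> \<open>Stripping \<open>t\<close> leads back to the level at which the split after
    \<open>p\<close> was made.\<close>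
  have edge: "((fst c (p @ False # t), fst c (p @ True # t)), snd c p t) \<in> W"
    if "c \<in> H (Suc (length p) + length t)" for c p t
  proof -
    have "append_config t c \<in> double W (length p) (H (length p))"
      using H_app[OF that] H(4) by blast
    then show ?thesis by (simp add: double_def append_config_def)
  qed
  have "\<exists>h. h \<in> H n" for n
    using H(1)[of n] unfolding positive_def by (meson countable_empty)
  then obtain h where h: "\<And>n. h n \<in> H n" by metis
  define a where "a n \<alpha> = fst (h n) (map \<alpha> [0..<n])" for n and \<alpha> :: "nat \<Rightarrow> bool"
  have aM: "a n \<alpha> \<in> M" for n \<alpha>
    unfolding a_def by (rule H(3)[OF h]) simp
  have split: "map \<alpha> [i..<m] = map \<alpha> [i..<n] @ map \<alpha> [n..<m]" if "i \<le> n" "n \<le> m" for \<alpha> :: "nat \<Rightarrow> bool" and i n m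
    using that by (metis le_add_diff_inverse map_append upt_add_eq_append)
  have a_close: "d (a n \<alpha>) (a m \<alpha>) \<le> (1/2) ^ n" if nm: "n \<le> m" for n m \<alpha>
  proof -
    have "append_config (map \<alpha> [n..<m]) (h m) \<in> H n"
      by (rule H_app) (use h[of m] nm in simp)
    then have "d (fst (h n) (map \<alpha> [0..<n])) (fst (append_config (map \<alpha> [n..<m]) (h m)) (map \<alpha> [0..<n])) \<le> (1/2) ^ n"
      by (intro thin_points[OF H(2) h]) auto
    then show ?thesis
      using split[of 0 n m \<alpha>] nm by (simp add: a_def append_config_def)
  qed
  have "MCauchy (\<lambda>n. a n \<alpha>)" for \<alpha>
    unfolding MCauchy_def
  proof (intro conjI allI impI)
    show "range (\<lambda>n. a n \<alpha>) \<subseteq> M" using aM by auto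
    fix e :: real assume "e > 0"
    then obtain N where N: "(1/2) ^ N < e / 2"
      using real_arch_pow_inv[of "e/2" "1/2"] by auto
    have "d (a n \<alpha>) (a m \<alpha>) < e" if "N \<le> n" "N \<le> m" for n m
      using a_close[OF that(1), of \<alpha>] a_close[OF that(2), of \<alpha>] N
        triangle'[of "a n \<alpha>" "a N \<alpha>" "a m \<alpha>"] aM by (simp add: commute)
    then show "\<exists>N. \<forall>n n'. N \<le> n \<longrightarrow> N \<le> n' \<longrightarrow> d (a n \<alpha>) (a n' \<alpha>) < e" by blast
  qed
  then have "\<exists>x. limitin mtopology (\<lambda>n. a n \<alpha>) x sequentially" for \<alpha>
    using complete unfolding mcomplete_def by blast
  then obtain \<phi> where \<phi>: "\<And>\<alpha>. limitin mtopology (\<lambda>n. a n \<alpha>) (\<phi> \<alpha>) sequentially" by metis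
  have \<phi>M: "\<phi> \<alpha> \<in> M" for \<alpha> using limitin_topspace[OF \<phi>] by simp
  have \<phi>_close: "d (a n \<alpha>) (\<phi> \<alpha>) \<le> (1/2) ^ n" for n \<alpha>
  proof (rule field_le_epsilon)
    fix e :: real assume e: "e > 0"
    then have "\<forall>\<^sub>F m in sequentially. a m \<alpha> \<in> M \<and> d (a m \<alpha>) (\<phi> \<alpha>) < e"
      using \<phi>[of \<alpha>] unfolding limit_metric_sequentially eventually_sequentially by blast
    then obtain m where "m \<ge> n" "d (a m \<alpha>) (\<phi> \<alpha>) < e"
      unfolding eventually_sequentially by (metis nle_le)
    then show "d (a n \<alpha>) (\<phi> \<alpha>) \<le> (1/2) ^ n + e"
      using a_close[of n m \<alpha>] triangle[of "a n \<alpha>" "a m \<alpha>" "\<phi> \<alpha>"] aM \<phi>M by simp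
  qed
  show ?thesis
  proof (rule that)
    show "\<phi> \<alpha> \<in> M" for \<alpha> by (rule \<phi>M)
    show "d (\<phi> \<alpha>) (\<phi> \<beta>) \<le> 2 * (1/2) ^ n" if "\<And>i. i < n \<Longrightarrow> \<alpha> i = \<beta> i" for n \<alpha> \<beta>
    proof -
      have "map \<alpha> [0..<n] = map \<beta> [0..<n]" using that by auto
      then have "a n \<alpha> = a n \<beta>" by (simp only: a_def)
      then show ?thesis
        using \<phi>_close[of n \<alpha>] \<phi>_close[of n \<beta>] triangle[of "\<phi> \<alpha>" "a n \<alpha>" "\<phi> \<beta>"] aM \<phi>M by (simp add: commute)
    qed
    show "(\<phi> \<alpha>, \<phi> (\<alpha>(i := True))) \<notin> F" if \<alpha>: "\<not> \<alpha> i" for \<alpha> i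
    proof -
      let ?\<beta> = "\<alpha>(i := True)"
      define p where "p = map \<alpha> [0..<i]"
      define t where "t n = map \<alpha> [Suc i..<n]" for n
      have len: "length p = i" "length (t n) = n - Suc i" for n by (simp_all add: p_def t_def)
      have \<alpha>n: "map \<alpha> [0..<n] = p @ False # t n" "map ?\<beta> [0..<n] = p @ True # t n" if "i < n" for n
      proof -
        have "[0..<n] = [0..<i] @ i # [Suc i..<n]"
          using that by (metis upt_add_eq_append upt_conv_Cons le_add_diff_inverse less_imp_le zero_le add_0)
        then show "map \<alpha> [0..<n] = p @ False # t n" "map ?\<beta> [0..<n] = p @ True # t n"
          using \<alpha> by (simp_all add: p_def t_def)
      qed
      define w where "w n = snd (h n) p (t n)" for n
      have w_stable: "w m j = w n j" if "i < n" "n \<le> m" "j < n" for n m j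
      proof -
        have "append_config (map \<alpha> [n..<m]) (h m) \<in> H n"
          by (rule H_app) (use h[of m] that in simp)
        then have "snd (append_config (map \<alpha> [n..<m]) (h m)) p (t n) j = snd (h n) p (t n) j"
          by (intro thin_witnesses[OF H(2) _ h]) (use that len in auto)
        moreover have "t m = t n @ map \<alpha> [n..<m]"
          unfolding t_def by (rule split) (use that in auto)
        ultimately show ?thesis by (simp add: w_def append_config_def)
      qed
      \<comment> \<open>Entry \<open>j\<close> is fixed from level \<open>max i j + 1\<close> on:
        the words must contain bit \<open>i\<close>, and thinness at level \<open>n\<close> fixes
        only the entries below \<open>n\<close>.\<close>
      define w' where "w' j = w (Suc (max i j)) j" for j
      have "(\<lambda>n. w n j) \<longlonglongrightarrow> w' j" for j
      proof (rule tendsto_eventually)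
        show "\<forall>\<^sub>F n in sequentially. w n j = w' j"
          using eventually_ge_at_top[of "Suc (max i j)"]
          by eventually_elim (auto simp: w'_def intro!: w_stable)
      qed
      then have w_lim: "w \<longlonglongrightarrow> w'"
        unfolding limitin_canonical_iff[symmetric] euclidean_product_topology[symmetric]
        by (subst limitin_componentwise) auto
      have "((\<phi> \<alpha>, \<phi> ?\<beta>), w') \<in> W"
      proof (rule limitin_closedin[OF _ W(1)])
        show "limitin (prod_topology (prod_topology mtopology mtopology) euclidean) (\<lambda>n. ((a n \<alpha>, a n ?\<beta>), w n)) ((\<phi> \<alpha>, \<phi> ?\<beta>), w') sequentially"
          using \<phi> w_lim by (simp add: limitin_pairwise o_def)
        show "\<forall>\<^sub>F n in sequentially. ((a n \<alpha>, a n ?\<beta>), w n) \<in> W"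
          using eventually_gt_at_top[of i]
        proof eventually_elim
          case (elim n)
          have "h n \<in> H (Suc (length p) + length (t n))"
            using h[of n] elim by (simp add: len)
          from edge[OF this] show ?case
            using \<alpha>n[OF elim] by (simp add: a_def w_def)
        qed
      qed simp
      then have "(\<phi> \<alpha>, \<phi> ?\<beta>) \<in> M \<times> M - F" unfolding W(2) by force
      then show ?thesis by blast
    qed
  qed
qed

end

text \<open>The complement of \<open>F\<close> is Borel, hence Suslin, which supplies the closed set
  of witnesses. Continuity is stated through cylinders over finite words, of which there are
  countably many, so that measurability on coin tosses can be read off.\<close>

proposition polish_one_bit_inequivalent:
  assumes X: "polish_topology X" and F: "equiv (topspace X) F" "F \<in> sets (borel_of (prod_topology X X))"
    and unc: "\<And>D. countable D \<Longrightarrow> \<exists>x\<in>topspace X. \<forall>d\<in>D. (d, x) \<notin> F"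
  obtains \<phi> :: "(nat \<Rightarrow> bool) \<Rightarrow> 'a" where
    "\<And>\<alpha>. \<phi> \<alpha> \<in> topspace X"
    "\<And>U. openin X U \<Longrightarrow> \<exists>L. \<phi> -` U = (\<Union>s\<in>L. {\<alpha>. \<forall>i < length s. \<alpha> i = s ! i})"
    "\<And>\<alpha> i. \<not> \<alpha> i \<Longrightarrow> (\<phi> \<alpha>, \<phi> (\<alpha>(i := True))) \<notin> F"
proof -
  obtain M d where Md: "Metric_space M d" "Metric_space.mcomplete M d" and XM: "X = Metric_space.mtopology M d"
    using X unfolding polish_topology_def completely_metrizable_space_def by blast
  interpret Metric_space M d by (rule Md)
  have tX: "topspace X = M" by (simp add: XM)
  have "metrizable_space X"
    using XM metrizable_space_mtopology by simp
  then have "metrizable_space (prod_topology X X)" by (simp add: metrizable_space_prod_topology)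
  moreover have "M \<times> M - F \<in> sets (borel_of (prod_topology X X))"
    using sets.compl_sets[OF F(2)] by (simp add: tX)
  ultimately have "suslin (prod_topology X X) (M \<times> M - F)"
    by (rule suslin_borel)
  then obtain W where W: "closedin (prod_topology (prod_topology mtopology mtopology) (euclidean :: (nat \<Rightarrow> nat) topology)) W" "M \<times> M - F = fst ` W"
    unfolding suslin_def XM by blast
  obtain \<phi> :: "(nat \<Rightarrow> bool) \<Rightarrow> 'a" where \<phi>: "\<And>\<alpha>. \<phi> \<alpha> \<in> M"
    "\<And>n \<alpha> \<beta>. (\<And>i. i < n \<Longrightarrow> \<alpha> i = \<beta> i) \<Longrightarrow> d (\<phi> \<alpha>) (\<phi> \<beta>) \<le> 2 * (1/2) ^ n"
    "\<And>\<alpha> i. \<not> \<alpha> i \<Longrightarrow> (\<phi> \<alpha>, \<phi> (\<alpha>(i := True))) \<notin> F"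
    by (rule continuous_one_bit_inequivalent[OF Md(2) _ _ W])
      (use X F unc in \<open>auto simp: polish_topology_def XM\<close>)
  show ?thesis
  proof (rule that)
    fix U assume U: "openin X U"
    let ?cyl = "\<lambda>s :: bool list. {\<alpha>. \<forall>i < length s. \<alpha> i = s ! i}"
    show "\<exists>L. \<phi> -` U = (\<Union>s\<in>L. ?cyl s)"
    proof (intro exI[of _ "{s. ?cyl s \<subseteq> \<phi> -` U}"] equalityI subsetI)
      fix \<alpha> assume "\<alpha> \<in> \<phi> -` U"
      then obtain r where r: "r > 0" "mball (\<phi> \<alpha>) r \<subseteq> U"
        using U unfolding XM openin_mtopology by blast
      obtain n where n: "(1/2) ^ n < r / 2"
        using real_arch_pow_inv[of "r/2" "1/2"] r by auto
      let ?s = "map \<alpha> [0..<n]"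
      have "?cyl ?s \<subseteq> \<phi> -` U"
      proof
        fix \<beta> assume "\<beta> \<in> ?cyl ?s"
        then have "d (\<phi> \<alpha>) (\<phi> \<beta>) \<le> 2 * (1/2) ^ n" by (intro \<phi>(2)) auto
        then have "\<phi> \<beta> \<in> mball (\<phi> \<alpha>) r" using n \<phi>(1) by auto
        then show "\<beta> \<in> \<phi> -` U" using r by auto
      qed
      moreover have "\<alpha> \<in> ?cyl ?s" by auto
      ultimately show "\<alpha> \<in> (\<Union>s\<in>{s. ?cyl s \<subseteq> \<phi> -` U}. ?cyl s)" by blast
    qed auto
  qed (use \<phi> in \<open>auto simp: tX\<close>)
qed

section \<open>Reducing the \<open>\<ell>\<^sub>1\<close> relation\<close>

text \<open>The elements are taken in increasing order as long as the running sum stays at most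
  \<open>t\<close>. The first one left out would push the sum beyond \<open>t\<close>, and its
  weight is at most \<open>e\<close>.\<close>

lemma initial_segment_sum:
  fixes f :: "nat \<Rightarrow> real" and B :: "nat set"
  defines "q n \<equiv> \<Sum>m\<in>{m\<in>B. m \<le> n}. f m"
  assumes B: "finite B" and f: "\<And>n. n \<in> B \<Longrightarrow> 0 \<le> f n" "\<And>n. n \<in> B \<Longrightarrow> f n \<le> e"
    and t: "0 \<le> t" "t \<le> sum f B" and e: "0 \<le> e"
  shows "sum f {n\<in>B. q n \<le> t} \<le> t" "t - e \<le> sum f {n\<in>B. q n \<le> t}"
proof -
  let ?I = "{n\<in>B. q n \<le> t}"
  show "sum f ?I \<le> t"
  proof (cases "?I = {}")
    case False
    have fin: "finite ?I" using B by simp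
    then have m: "Max ?I \<in> ?I" using False by (rule Max_in)
    have "sum f ?I \<le> q (Max ?I)"
      unfolding q_def by (rule sum_mono2) (use B f fin in auto)
    then show ?thesis using m by auto
  next
    case True
    show ?thesis unfolding True using t by simp
  qed
  show "t - e \<le> sum f ?I"
  proof (cases "?I = B")
    case False
    define n where "n = Min (B - ?I)"
    have fin: "finite (B - ?I)" "B - ?I \<noteq> {}" using B False by auto
    have n: "n \<in> B - ?I" unfolding n_def using fin by (rule Min_in)
    have less: "m \<in> ?I" if "m \<in> B" "m < n" for m
      using Min_le[OF fin(1), of m] that by (auto simp: n_def)
    have "{m\<in>B. m \<le> n} = insert n {m\<in>B. m < n}" using n by auto
    then have "q n = f n + sum f {m\<in>B. m < n}"
      unfolding q_def using B by simp
    also have "sum f {m\<in>B. m < n} \<le> sum f ?I"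
      by (rule sum_mono2) (use B f less in auto)
    also have "f n \<le> e" using f n by auto
    finally show ?thesis using n by auto
  qed (use t e in simp)
qed

section \<open>Coding real sequences by sequences in the unit interval\<close>

definition clamp01 :: "real \<Rightarrow> real" where
  "clamp01 r = max 0 (min 1 r)"

lemma clamp01_bounds: "0 \<le> clamp01 r" "clamp01 r \<le> 1"
  by (simp_all add: clamp01_def)

lemma clamp01_mono: "r \<le> s \<Longrightarrow> clamp01 r \<le> clamp01 s"
  by (auto simp: clamp01_def)

text \<open>Each summand is the length of the part of \<open>[z, z + 1]\<close> below
  \<open>r\<close>, so the sum is the length of the part of \<open>[A, B]\<close> below
  \<open>r\<close>.\<close>

lemma sum_clamp01:
  fixes A B :: int
  assumes "A \<le> B"
  shows "(\<Sum>z\<in>{A..<B}. clamp01 (r - real_of_int z)) = max 0 (min (real_of_int (B - A)) (r - real_of_int A))"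
  using assms
proof (induction B rule: int_ge_induct)
  case (step B)
  have "{A..<B + 1} = insert B {A..<B}" using step.hyps by auto
  then show ?case using step by (simp add: clamp01_def)
qed simp

text \<open>The real line is cut into unit intervals, so that a difference becomes a sum of differences in \<open>[0, 1]\<close>.\<close>

lemma has_sum_clamp01_diff:
  "((\<lambda>z :: int. \<bar>clamp01 (r - real_of_int z) - clamp01 (s - real_of_int z)\<bar>) has_sum \<bar>r - s\<bar>) UNIV"
proof -
  have *: "((\<lambda>z :: int. \<bar>clamp01 (r - real_of_int z) - clamp01 (s - real_of_int z)\<bar>) has_sum \<bar>r - s\<bar>) UNIV"
    if rs: "r \<le> s" for r s :: real
  proof (rule has_sum_finite_neutralI)
    define A where "A = \<lfloor>r\<rfloor>"
    define B where "B = \<lceil>s\<rceil>"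
    have A: "real_of_int A \<le> r" "r < real_of_int A + 1" and B: "s \<le> real_of_int B"
      by (simp_all add: A_def B_def)
    have AB: "A \<le> B" using A B rs by linarith
    show "finite {A..<B}" "{A..<B} \<subseteq> UNIV" by auto
    show "\<bar>clamp01 (r - real_of_int z) - clamp01 (s - real_of_int z)\<bar> = 0" if z: "z \<in> UNIV - {A..<B}" for z
    proof (cases "z < A")
      case True
      then have "real_of_int z + 1 \<le> real_of_int A" by linarith
      then show ?thesis using A rs by (simp add: clamp01_def)
    next
      case False
      then have "real_of_int B \<le> real_of_int z" using z by auto
      then show ?thesis using B rs by (simp add: clamp01_def)
    qed
    have "(\<Sum>z\<in>{A..<B}. \<bar>clamp01 (r - real_of_int z) - clamp01 (s - real_of_int z)\<bar>)
        = (\<Sum>z\<in>{A..<B}. clamp01 (s - real_of_int z) - clamp01 (r - real_of_int z))"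
      by (intro sum.cong refl) (use clamp01_mono rs in \<open>simp add: abs_of_nonpos\<close>)
    also have "\<dots> = (s - real_of_int A) - (r - real_of_int A)"
      unfolding sum_subtractf sum_clamp01[OF AB] using A B rs by simp
    finally show "\<bar>r - s\<bar> = (\<Sum>z\<in>{A..<B}. \<bar>clamp01 (r - real_of_int z) - clamp01 (s - real_of_int z)\<bar>)"
      using rs by simp
  qed
  show ?thesis
  proof (cases "r \<le> s")
    case False
    then show ?thesis using *[of s r] by (simp add: abs_minus_commute)
  qed (rule *)
qed

text \<open>A reduction modulo l1 of real sequences to sequences in \<open>[0, 1]\<close>: the index
  \<open>j\<close> decodes to a coordinate \<open>k\<close> and an integer \<open>z\<close>, and the
  entry tells how much of \<open>[z, z + 1]\<close> lies below \<open>x k\<close>.\<close>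

definition line_code :: "(nat \<Rightarrow> real) \<Rightarrow> nat \<Rightarrow> real" where
  "line_code x j = clamp01 (x (fst (prod_decode j)) - real_of_int (int_decode (snd (prod_decode j))))"

text \<open>For fixed \<open>k\<close> the differences over all integers add up to exactly
  \<open>\<bar>x k - y k\<bar>\<close>, and nonnegative terms may be regrouped.\<close>

lemma summable_line_code_diff:
  "summable (\<lambda>j. \<bar>line_code x j - line_code y j\<bar>) \<longleftrightarrow> summable (\<lambda>k. \<bar>x k - y k\<bar>)"
proof -
  define g :: "nat \<times> int \<Rightarrow> real" where
    "g = (\<lambda>(k, z). \<bar>clamp01 (x k - real_of_int z) - clamp01 (y k - real_of_int z)\<bar>)"
  have bij: "bij (\<lambda>j. (fst (prod_decode j), int_decode (snd (prod_decode j))))"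
  proof -
    have "bij (map_prod id int_decode :: nat \<times> nat \<Rightarrow> nat \<times> int)"
      using bij_betw_map_prod[OF bij_id bij_int_decode] by simp
    from bij_comp[OF bij_prod_decode this] show ?thesis
      by (simp add: comp_def map_prod_def split_beta)
  qed
  have "summable (\<lambda>j. \<bar>line_code x j - line_code y j\<bar>) \<longleftrightarrow> (\<lambda>j. \<bar>line_code x j - line_code y j\<bar>) summable_on UNIV"
    by (rule summable_on_UNIV_nonneg_real_iff[symmetric]) simp
  also have "\<dots> \<longleftrightarrow> g summable_on UNIV"
    using summable_on_reindex_bij_betw[OF bij, of g] by (simp add: g_def line_code_def)
  also have "\<dots> \<longleftrightarrow> (\<lambda>p. norm (g p)) summable_on (SIGMA k:UNIV. UNIV)"
    by (simp add: g_def case_prod_unfold)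
  also have "\<dots> \<longleftrightarrow> (\<lambda>k. norm \<bar>x k - y k\<bar>) summable_on UNIV"
    unfolding Infinite_Sum.abs_summable_on_Sigma_iff
    using has_sum_clamp01_diff[THEN has_sum_imp_summable] has_sum_clamp01_diff[THEN infsumI]
    by (simp add: g_def)
  also have "\<dots> \<longleftrightarrow> summable (\<lambda>k. \<bar>x k - y k\<bar>)"
    by (simp add: summable_on_UNIV_nonneg_real_iff)
  finally show ?thesis .
qed

lemma summable_on_disjoint_finite_blocks:
  fixes g :: "'b \<Rightarrow> real" and B :: "nat \<Rightarrow> 'b set"
  assumes disj: "disjoint_family B" and fin: "\<And>j. finite (B j)" and g: "\<And>n. 0 \<le> g n"
  shows "g summable_on (\<Union>j. B j) \<longleftrightarrow> summable (\<lambda>j. sum g (B j))"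
proof -
  have inj: "inj_on snd (SIGMA j:UNIV. B j)"
    using disj by (auto simp: inj_on_def disjoint_family_on_def)
  have "(\<Union>j. B j) = snd ` (SIGMA j:UNIV. B j)" by force
  then have "g summable_on (\<Union>j. B j) \<longleftrightarrow> (\<lambda>p. norm (g (snd p))) summable_on (SIGMA j:UNIV. B j)"
    using summable_on_reindex[OF inj, of g] g by (simp add: o_def)
  also have "\<dots> \<longleftrightarrow> (\<lambda>j. norm (sum g (B j))) summable_on UNIV"
    unfolding Infinite_Sum.abs_summable_on_Sigma_iff using fin g by (simp add: sum_nonneg)
  also have "\<dots> \<longleftrightarrow> summable (\<lambda>j. sum g (B j))"
    using g by (simp add: summable_on_UNIV_nonneg_real_iff sum_nonneg)
  finally show ?thesis .
qed

section \<open>The summation relation and its two-valued points\<close>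

locale sum_equiv =
  fixes X :: "nat \<Rightarrow> 'a topology" and \<psi> :: "nat \<Rightarrow> 'a \<times> 'a \<Rightarrow> real"
  assumes nonempty: "\<And>n. topspace (X n) \<noteq> {}"
    and nonneg: "\<And>n x y. x \<in> topspace (X n) \<Longrightarrow> y \<in> topspace (X n) \<Longrightarrow> 0 \<le> \<psi> n (x, y)"
    and equiv: "equiv (topspace (product_topology X UNIV)) (sum_rel (\<lambda>n. topspace (X n)) \<psi>)"
begin

abbreviation E :: "((nat \<Rightarrow> 'a) \<times> (nat \<Rightarrow> 'a)) set" where
  "E \<equiv> sum_rel (\<lambda>n. topspace (X n)) \<psi>"

lemma E_iff:
  assumes "\<And>n. x n \<in> topspace (X n)" "\<And>n. y n \<in> topspace (X n)"
  shows "(x, y) \<in> E \<longleftrightarrow> summable (\<lambda>n. \<psi> n (x n, y n))"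
  using assms by (auto simp: sum_rel_def)

lemma E_refl: "(\<And>n. x n \<in> topspace (X n)) \<Longrightarrow> (x, x) \<in> E"
  using equiv by (auto simp: equiv_def refl_on_def)

lemma E_sym: "(x, y) \<in> E \<Longrightarrow> (y, x) \<in> E"
  using equiv by (meson equiv_def symD)

lemma E_trans: "(x, y) \<in> E \<Longrightarrow> (y, z) \<in> E \<Longrightarrow> (x, z) \<in> E"
  using equiv by (meson equiv_def transD)

text \<open>The terms \<open>\<psi> n (v n, u n)\<close> and those on the diagonal are controlled
  only through \<open>E\<close>. Symmetry of \<open>E\<close> gives one direction. For the other,
  each point is compared with their minimum \<open>a n \<and> b n\<close>: this produces only terms
  \<open>\<psi> n (u n, v n)\<close> and diagonal terms, summable by reflexivity. Symmetry and
  transitivity then join the two comparisons.\<close>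

lemma two_point_iff:
  fixes a b :: "nat \<Rightarrow> bool"
  assumes u: "\<And>n. u n \<in> topspace (X n)" and v: "\<And>n. v n \<in> topspace (X n)"
  shows "(\<lambda>n. if a n then v n else u n, \<lambda>n. if b n then v n else u n) \<in> E \<longleftrightarrow>
    summable (\<lambda>n. if a n \<noteq> b n then \<psi> n (u n, v n) else 0)" (is "_ \<longleftrightarrow> summable ?f")
proof
  let ?p = "\<lambda>c n. if c n then v n else u n"
  have p: "?p c n \<in> topspace (X n)" for c n using u v by simp
  have iff: "(?p c, ?p c') \<in> E \<longleftrightarrow> summable (\<lambda>n. \<psi> n (?p c n, ?p c' n))" for c c'
    by (rule E_iff) (rule p)+
  assume ab: "(?p a, ?p b) \<in> E"
  have "summable (\<lambda>n. \<psi> n (?p a n, ?p b n) + \<psi> n (?p b n, ?p a n))"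
    using ab E_sym[OF ab] unfolding iff by (rule summable_add)
  moreover have "norm (?f n) \<le> \<psi> n (?p a n, ?p b n) + \<psi> n (?p b n, ?p a n)" for n
    using u v nonneg by simp
  ultimately show "summable ?f" by (rule summable_comparison_test')
next
  let ?p = "\<lambda>c n. if c n then v n else u n"
  have p: "?p c n \<in> topspace (X n)" for c n using u v by simp
  have iff: "(?p c, ?p c') \<in> E \<longleftrightarrow> summable (\<lambda>n. \<psi> n (?p c n, ?p c' n))" for c c'
    by (rule E_iff) (rule p)+
  assume f: "summable ?f"
  have below: "(?p c, ?p a') \<in> E" if c: "\<And>n. c n \<Longrightarrow> a' n" "\<And>n. a' n \<Longrightarrow> \<not> c n \<Longrightarrow> a n \<noteq> b n" for c a'
  proof -
    have "summable (\<lambda>n. ?f n + \<psi> n (?p a' n, ?p a' n))"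
    proof (rule summable_add[OF f])
      have "(?p a', ?p a') \<in> E" by (rule E_refl) (rule p)
      then show "summable (\<lambda>n. \<psi> n (?p a' n, ?p a' n))" unfolding iff .
    qed
    moreover have "norm (\<psi> n (?p c n, ?p a' n)) \<le> ?f n + \<psi> n (?p a' n, ?p a' n)" for n
      using c[of n] u[of n] v[of n] nonneg by auto
    ultimately have "summable (\<lambda>n. \<psi> n (?p c n, ?p a' n))"
      by (rule summable_comparison_test')
    then show ?thesis unfolding iff .
  qed
  have "(?p (\<lambda>n. a n \<and> b n), ?p a) \<in> E" "(?p (\<lambda>n. a n \<and> b n), ?p b) \<in> E"
    by (rule below; auto)+
  then show "(?p a, ?p b) \<in> E" using E_sym E_trans by blast
qed

text \<open>Block \<open>j\<close> stores \<open>line_code x j\<close>, scaled by the total weight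
  \<open>S j\<close>, as an initial segment on which the value \<open>v n\<close> is taken. Initial
  segments are nested, so the weight of the disagreement is the difference of the two weights; it
  differs from the scaled difference of the numbers by at most \<open>(1/2)^j\<close>, which is
  summable. Totals between \<open>1\<close> and \<open>2\<close> make the scaling harmless.\<close>

proposition ell1_reducible_of_blocks:
  fixes B :: "nat \<Rightarrow> nat set"
  assumes sc: "\<And>n. second_countable (X n)"
    and u: "\<And>n. u n \<in> topspace (X n)" and v: "\<And>n. v n \<in> topspace (X n)"
    and disj: "disjoint_family B" and fin: "\<And>j. finite (B j)"
    and small: "\<And>j n. n \<in> B j \<Longrightarrow> \<psi> n (u n, v n) \<le> (1/2) ^ j"
    and total: "\<And>j. 1 \<le> (\<Sum>n\<in>B j. \<psi> n (u n, v n))" "\<And>j. (\<Sum>n\<in>B j. \<psi> n (u n, v n)) \<le> 2"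
  shows "borel_reducible (powertop_real UNIV) RN_mod_ell1 (product_topology X UNIV) E"
proof -
  define f where "f n = \<psi> n (u n, v n)" for n
  have f: "0 \<le> f n" for n using nonneg u v by (simp add: f_def)
  define S where "S j = sum f (B j)" for j
  have S: "1 \<le> S j" "S j \<le> 2" for j using total by (simp_all add: S_def f_def)
  define q where "q j n = (\<Sum>m\<in>{m\<in>B j. m \<le> n}. f m)" for j n
  define a where "a x n \<longleftrightarrow> (\<exists>j. n \<in> B j \<and> q j n \<le> S j * line_code x j)" for x :: "nat \<Rightarrow> real" and n
  have a_block: "a x n \<longleftrightarrow> q j n \<le> S j * line_code x j" if "n \<in> B j" for x n j
  proof -
    have "n \<in> B i \<longleftrightarrow> i = j" for i
      using that disj by (auto simp: disjoint_family_on_def)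
    then show ?thesis by (simp add: a_def)
  qed
  define \<theta> where "\<theta> x = (\<lambda>n. if a x n then v n else u n)" for x
  define G where "G x j = sum f {n\<in>B j. a x n}" for x j
  have G: "S j * line_code x j - (1/2) ^ j \<le> G x j" "G x j \<le> S j * line_code x j" for x j
  proof -
    have "{n\<in>B j. a x n} = {n\<in>B j. q j n \<le> S j * line_code x j}" using a_block by auto
    moreover have "0 \<le> S j * line_code x j" "S j * line_code x j \<le> sum f (B j)"
      using S[of j] clamp01_bounds mult_left_mono[of "line_code x j" 1 "S j"]
      by (auto simp: line_code_def S_def[symmetric])
    ultimately show "S j * line_code x j - (1/2) ^ j \<le> G x j" "G x j \<le> S j * line_code x j"
      unfolding G_def q_def
      using initial_segment_sum[where B = "B j" and f = f and e = "(1/2) ^ j" and t = "S j * line_code x j"] fin f small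
      by (simp_all add: f_def)
  qed
  have block_sum: "(\<Sum>n\<in>B j. if a x n \<noteq> a y n then f n else 0) = \<bar>G x j - G y j\<bar>" for x y j
  proof -
    have *: "(\<Sum>n\<in>B j. if a x n \<noteq> a y n then f n else 0) = G y j - G x j"
      if "line_code x j \<le> line_code y j" for x y
    proof -
      have "a y n" if "n \<in> B j" "a x n" for n
        using that a_block \<open>line_code x j \<le> line_code y j\<close> mult_left_mono[of "line_code x j" "line_code y j" "S j"] S[of j]
        by (meson order_trans zero_le_one)
      then have sub: "{n\<in>B j. a x n} \<subseteq> {n\<in>B j. a y n}" by blast
      have "(\<Sum>n\<in>B j. if a x n \<noteq> a y n then f n else 0) = sum f {n\<in>B j. a x n \<noteq> a y n}"
        using sum.inter_filter[OF fin] by metis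
      also have "{n\<in>B j. a x n \<noteq> a y n} = {n\<in>B j. a y n} - {n\<in>B j. a x n}" using sub by blast
      also have "sum f \<dots> = G y j - G x j"
        unfolding G_def by (rule sum_diff[OF _ sub]) (use fin in simp)
      finally show ?thesis .
    qed
    have nn: "0 \<le> (\<Sum>n\<in>B j. if a x n \<noteq> a y n then f n else 0)"
      by (rule sum_nonneg) (use f in simp)
    show ?thesis
    proof (cases "line_code x j \<le> line_code y j")
      case True
      then show ?thesis using *[of x y] nn by simp
    next
      case False
      then have "(\<Sum>n\<in>B j. if a y n \<noteq> a x n then f n else 0) = G x j - G y j" using *[of y x] by simp
      moreover have "(\<Sum>n\<in>B j. if a y n \<noteq> a x n then f n else 0) = (\<Sum>n\<in>B j. if a x n \<noteq> a y n then f n else 0)"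
        by (rule sum.cong) auto
      ultimately show ?thesis using nn by simp
    qed
  qed
  have red: "(x, y) \<in> RN_mod_ell1 \<longleftrightarrow> (\<theta> x, \<theta> y) \<in> E" for x y
  proof -
    let ?g = "\<lambda>n. if a x n \<noteq> a y n then f n else 0"
    have g: "0 \<le> ?g n" for n using f by simp
    have "(\<theta> x, \<theta> y) \<in> E \<longleftrightarrow> summable ?g"
      unfolding \<theta>_def f_def by (rule two_point_iff[OF u v])
    also have "\<dots> \<longleftrightarrow> ?g summable_on UNIV"
      by (rule summable_on_UNIV_nonneg_real_iff[symmetric]) (rule g)
    also have "\<dots> \<longleftrightarrow> ?g summable_on (\<Union>j. B j)"
      by (rule summable_on_cong_neutral) (auto simp: a_def)
    also have "\<dots> \<longleftrightarrow> summable (\<lambda>j. \<bar>G x j - G y j\<bar>)"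
      by (subst summable_on_disjoint_finite_blocks[OF disj fin g]) (simp only: block_sum)
    also have "\<dots> \<longleftrightarrow> summable (\<lambda>j. \<bar>line_code x j - line_code y j\<bar>)"
    proof
      have D: "\<bar>S j * line_code x j - S j * line_code y j\<bar> = S j * \<bar>line_code x j - line_code y j\<bar>" for j
        using S[of j] by (simp add: right_diff_distrib[symmetric] abs_mult)
      have geo: "summable (\<lambda>j. (1/2 :: real) ^ j)" by simp
      {
        assume "summable (\<lambda>j. \<bar>G x j - G y j\<bar>)"
        then have "summable (\<lambda>j. \<bar>G x j - G y j\<bar> + (1/2) ^ j)" using geo by (rule summable_add)
        moreover have "norm \<bar>line_code x j - line_code y j\<bar> \<le> \<bar>G x j - G y j\<bar> + (1/2) ^ j" for j
        proof -
          have "\<bar>line_code x j - line_code y j\<bar> \<le> S j * \<bar>line_code x j - line_code y j\<bar>"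
            using mult_right_mono[OF S(1)[of j], of "\<bar>line_code x j - line_code y j\<bar>"] by simp
          also have "\<dots> \<le> \<bar>G x j - G y j\<bar> + (1/2) ^ j"
            unfolding D[symmetric] using G[where x = x and j = j] G[where x = y and j = j] by linarith
          finally show ?thesis by simp
        qed
        ultimately show "summable (\<lambda>j. \<bar>line_code x j - line_code y j\<bar>)"
          by (rule summable_comparison_test')
      next
        assume "summable (\<lambda>j. \<bar>line_code x j - line_code y j\<bar>)"
        then have "summable (\<lambda>j. 2 * \<bar>line_code x j - line_code y j\<bar> + (1/2) ^ j)"
          using geo by (intro summable_add summable_mult)
        moreover have "norm \<bar>G x j - G y j\<bar> \<le> 2 * \<bar>line_code x j - line_code y j\<bar> + (1/2) ^ j" for j
        proof -
          have "\<bar>G x j - G y j\<bar> \<le> S j * \<bar>line_code x j - line_code y j\<bar> + (1/2) ^ j"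
            unfolding D[symmetric] using G[where x = x and j = j] G[where x = y and j = j] by linarith
          also have "S j * \<bar>line_code x j - line_code y j\<bar> \<le> 2 * \<bar>line_code x j - line_code y j\<bar>"
            by (rule mult_right_mono[OF S(2)]) simp
          finally show ?thesis by simp
        qed
        ultimately show "summable (\<lambda>j. \<bar>G x j - G y j\<bar>)"
          by (rule summable_comparison_test')
      }
    qed
    also have "\<dots> \<longleftrightarrow> (x, y) \<in> RN_mod_ell1"
      by (simp add: summable_line_code_diff RN_mod_ell1_def ell1_def)
    finally show ?thesis by simp
  qed
  have "\<theta> \<in> borel_of (powertop_real UNIV) \<rightarrow>\<^sub>M borel_of (product_topology X UNIV)"
  proof (rule measurable_into_product_topology[OF sc])
    fix n
    have coord [measurable]: "(\<lambda>x. x k) \<in> borel_measurable (borel_of (powertop_real UNIV))" for k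
      using continuous_map_measurable[OF continuous_map_product_coordinates[of k UNIV "\<lambda>_. euclideanreal"]]
      by (simp add: borel_of_euclidean)
    have [measurable]: "(\<lambda>x. line_code x j) \<in> borel_measurable (borel_of (powertop_real UNIV))" for j
      unfolding line_code_def clamp01_def by measurable
    have [measurable]: "Measurable.pred (borel_of (powertop_real UNIV)) (\<lambda>x. a x n)"
      unfolding a_def by measurable
    show "(\<lambda>x. \<theta> x n) \<in> borel_of (powertop_real UNIV) \<rightarrow>\<^sub>M borel_of (X n)"
      unfolding \<theta>_def
    proof (rule measurable_If)
      show "{x \<in> space (borel_of (powertop_real UNIV)). a x n} \<in> sets (borel_of (powertop_real UNIV))"
        by measurable
    qed (use u v in auto)
  qed
  then show ?thesis
    unfolding borel_reducible_def using red by blast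
qed

end

section \<open>Countable tail relations\<close>

lemma measurable_borel_of_discrete:
  assumes "f \<in> N \<rightarrow>\<^sub>M count_space UNIV"
  shows "f \<in> N \<rightarrow>\<^sub>M borel_of (discrete_topology UNIV)"
  by (rule measurable_borel_ofI) (use measurable_sets[OF assms] in auto)

lemma measurable_product_component:
  "(\<lambda>x. x n) \<in> borel_of (product_topology X UNIV) \<rightarrow>\<^sub>M borel_of (X n)"
  by (rule continuous_map_measurable[OF continuous_map_product_coordinates]) simp

lemma E0_iff_finite: "(x, y) \<in> E0 \<longleftrightarrow> finite {m. x m \<noteq> y m}"
proof -
  have "(x, y) \<in> E0 \<longleftrightarrow> (\<forall>\<^sub>F m in cofinite. x m = y m)"
    by (simp add: E0_def cofinite_eq_sequentially eventually_sequentially)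
  then show ?thesis by (simp add: eventually_cofinite)
qed

section \<open>Blocks from small values that are not summable\<close>

context sum_equiv
begin

definition is_block :: "(nat \<Rightarrow> 'a) \<Rightarrow> (nat \<Rightarrow> 'a) \<Rightarrow> real \<Rightarrow> nat \<Rightarrow> nat \<Rightarrow> nat set \<Rightarrow> bool" where
  "is_block u v \<epsilon> M K B \<longleftrightarrow> B \<subseteq> {M..<K} \<and> (\<forall>n\<in>B. \<psi> n (u n, v n) \<le> \<epsilon>) \<and>
    1 \<le> (\<Sum>n\<in>B. \<psi> n (u n, v n)) \<and> (\<Sum>n\<in>B. \<psi> n (u n, v n)) \<le> 2"

text \<open>Up to a factor \<open>2\<close>, the pair \<open>(u n, v n)\<close> attains the supremum
  of the values below \<open>\<delta>\<close>. If its weights \<open>r n\<close> were summable,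
  their doubles would dominate all these values. So they have infinite sum beyond every
  \<open>M\<close>, and being at most \<open>1\<close> they can be stopped at a total between
  \<open>1\<close> and \<open>2\<close>.\<close>

lemma exists_block:
  assumes \<delta>: "0 < \<delta>" "\<delta> \<le> 1"
    and no: "\<And>s. summable s \<Longrightarrow> \<exists>n. \<exists>x\<in>topspace (X n). \<exists>y\<in>topspace (X n). \<psi> n (x, y) < \<delta> \<and> s n < \<psi> n (x, y)"
  shows "\<exists>u v. (\<forall>n. u n \<in> topspace (X n) \<and> v n \<in> topspace (X n)) \<and>
    (\<forall>M. \<exists>K B. is_block u v \<delta> M K B)"
proof -
  have "\<exists>u\<in>topspace (X n). \<exists>v\<in>topspace (X n). \<forall>x\<in>topspace (X n). \<forall>y\<in>topspace (X n).
      \<psi> n (x, y) < \<delta> \<longrightarrow> \<psi> n (u, v) < \<delta> \<and> \<psi> n (x, y) \<le> 2 * \<psi> n (u, v)" for n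
  proof -
    define A where "A = {\<psi> n (x, y) | x y. x \<in> topspace (X n) \<and> y \<in> topspace (X n) \<and> \<psi> n (x, y) < \<delta>}"
    show ?thesis
    proof (cases "A = {}")
      \<comment> \<open>If no value is below \<open>\<delta>\<close>, any pair serves, and its
        truncated weight \<open>r n\<close> below is \<open>0\<close>.\<close>
      case True
      then show ?thesis using nonempty[of n] unfolding A_def by blast
    next
      case False
      have bdd: "bdd_above A" by (rule bdd_aboveI[of _ \<delta>]) (auto simp: A_def)
      have nn: "0 \<le> a" if "a \<in> A" for a using that nonneg by (auto simp: A_def)
      have "\<exists>a\<in>A. Sup A \<le> 2 * a"
      proof (cases "Sup A \<le> 0")
        case True
        then show ?thesis using False nn by fastforce
      next
        case False
        then have "Sup A / 2 < Sup A" by simp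
        then obtain a where "a \<in> A" "Sup A / 2 < a"
          using less_cSup_iff[OF \<open>A \<noteq> {}\<close> bdd] by blast
        then show ?thesis by (intro bexI[of _ a]) auto
      qed
      then obtain a where "a \<in> A" "Sup A \<le> 2 * a" by blast
      moreover have "b \<le> Sup A" if "b \<in> A" for b using that bdd by (rule cSup_upper)
      ultimately have "a \<in> A" "\<And>b. b \<in> A \<Longrightarrow> b \<le> 2 * a" by force+
      then show ?thesis unfolding A_def by blast
    qed
  qed
  then obtain u v where u: "\<And>n. u n \<in> topspace (X n)" and v: "\<And>n. v n \<in> topspace (X n)"
    and uv: "\<And>n x y. x \<in> topspace (X n) \<Longrightarrow> y \<in> topspace (X n) \<Longrightarrow> \<psi> n (x, y) < \<delta> \<Longrightarrow>
      \<psi> n (u n, v n) < \<delta> \<and> \<psi> n (x, y) \<le> 2 * \<psi> n (u n, v n)"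
    by metis
  define f where "f n = \<psi> n (u n, v n)" for n
  define r where "r n = (if f n < \<delta> then f n else 0)" for n
  have r: "0 \<le> r n" "r n \<le> 1" for n
    using nonneg[OF u v, of n] \<delta> by (auto simp: r_def f_def)
  have not_sm: "\<not> summable r"
  proof
    assume "summable r"
    then have "summable (\<lambda>n. 2 * r n)" by (rule summable_mult)
    then obtain n x y where "x \<in> topspace (X n)" "y \<in> topspace (X n)" "\<psi> n (x, y) < \<delta>" "2 * r n < \<psi> n (x, y)"
      using no by blast
    then show False using uv[of x n y] by (auto simp: r_def f_def)
  qed
  have "\<exists>K B. B \<subseteq> {M..<K} \<and> (\<forall>n\<in>B. f n \<le> \<delta>) \<and> 1 \<le> sum f B \<and> sum f B \<le> 2" for M
  proof -
    have "\<exists>K. 1 \<le> sum r {M..<K}"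
    proof (rule ccontr)
      assume "\<nexists>K. 1 \<le> sum r {M..<K}"
      then have lt: "sum r {M..<K} < 1" for K by (simp add: not_le)
      have "summable r"
      proof (rule summableI_nonneg_bounded[OF r(1)])
        fix K
        have "sum r {..<K} \<le> sum r ({..<M} \<union> {M..<K})"
          by (rule sum_mono2) (use r in auto)
        also have "\<dots> = sum r {..<M} + sum r {M..<K}"
          by (rule sum.union_disjoint) auto
        also have "\<dots> \<le> sum r {..<M} + 1" using lt[of K] by simp
        finally show "sum r {..<K} \<le> sum r {..<M} + 1" .
      qed
      then show False using not_sm by simp
    qed
    then have K: "1 \<le> sum r {M..<(LEAST K. 1 \<le> sum r {M..<K})}" by (rule LeastI_ex)
    \<comment> \<open>By minimality the sum without its last term is below \<open>1\<close>, so with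
      that term it is at most \<open>2\<close>.\<close>
    define K where "K = (LEAST K. 1 \<le> sum r {M..<K})"
    note K = K[folded K_def]
    have "M < K" using K by (cases "M < K") auto
    then obtain K' where K': "K = Suc K'" "M \<le> K'" by (cases K) auto
    have "\<not> 1 \<le> sum r {M..<K'}"
      using not_less_Least[of K' "\<lambda>K. 1 \<le> sum r {M..<K}"] K' by (simp add: K_def)
    then have "sum r {M..<K} \<le> 2" using K' r(2)[of K'] by simp
    moreover have "sum f {n\<in>{M..<K}. f n < \<delta>} = sum r {M..<K}"
      unfolding r_def by (rule sum.inter_filter) simp
    ultimately show ?thesis
      using K by (intro exI[of _ K] exI[of _ "{n\<in>{M..<K}. f n < \<delta>}"]) auto
  qed
  then show ?thesis
    using u v unfolding f_def is_block_def by (intro exI[of _ u] exI[of _ v]) simp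
qed

text \<open>The terms have to tend to \<open>0\<close>, so block \<open>j\<close> is built for the
  bound \<open>(1/2)^j\<close>, with its own pair of sequences, beginning where the previous block
  ends.\<close>

lemma ell1_reducible_of_not_small:
  assumes sc: "\<And>n. second_countable (X n)"
    and no: "\<And>\<delta> s. 0 < \<delta> \<Longrightarrow> summable s \<Longrightarrow>
      \<exists>n. \<exists>x\<in>topspace (X n). \<exists>y\<in>topspace (X n). \<psi> n (x, y) < \<delta> \<and> s n < \<psi> n (x, y)"
  shows "borel_reducible (powertop_real UNIV) RN_mod_ell1 (product_topology X UNIV) E"
proof -
  have "\<exists>u v. (\<forall>n. u n \<in> topspace (X n) \<and> v n \<in> topspace (X n)) \<and>
    (\<forall>M. \<exists>K B. is_block u v ((1/2) ^ j) M K B)" for j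
    by (rule exists_block) (use no in \<open>auto simp: power_le_one\<close>)
  then obtain u v where uv: "\<And>j n. u j n \<in> topspace (X n)" "\<And>j n. v j n \<in> topspace (X n)"
    and ex: "\<And>j M. \<exists>K B. is_block (u j) (v j) ((1/2) ^ j) M K B"
    by metis
  from ex obtain K B where "\<And>j M. is_block (u j) (v j) ((1/2) ^ j) M (K j M) (B j M)"
    by metis
  then have KB: "\<And>j M. B j M \<subseteq> {M..<K j M}"
    "\<And>j M n. n \<in> B j M \<Longrightarrow> \<psi> n (u j n, v j n) \<le> (1/2) ^ j"
    "\<And>j M. 1 \<le> (\<Sum>n\<in>B j M. \<psi> n (u j n, v j n))" "\<And>j M. (\<Sum>n\<in>B j M. \<psi> n (u j n, v j n)) \<le> 2"
    unfolding is_block_def by blast+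
  define m where "m = rec_nat 0 K"
  have m_Suc: "m (Suc j) = K j (m j)" for j by (simp add: m_def)
  define C where "C j = B j (m j)" for j
  have C_sub: "C j \<subseteq> {m j..<m (Suc j)}" for j using KB(1) by (simp add: C_def m_Suc)
  have "m j \<le> m (Suc j)" for j
  proof -
    have "C j \<noteq> {}" using KB(3)[of j "m j"] by (auto simp: C_def)
    then show ?thesis using C_sub[of j] by auto
  qed
  then have mono: "m i \<le> m j" if "i \<le> j" for i j
    using that by (rule lift_Suc_mono_le)
  have C_disj: "i = j" if "n \<in> C i" "n \<in> C j" for i j n
  proof (rule ccontr)
    assume "i \<noteq> j"
    then consider "Suc i \<le> j" | "Suc j \<le> i" by linarith
    then show False using C_sub[of i] C_sub[of j] that by cases (use mono in fastforce)+
  qed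
  \<comment> \<open>The pairs for the different bounds are merged by using at \<open>n\<close> the
    pair of the block that contains \<open>n\<close>; outside the blocks the choice is
    arbitrary.\<close>
  define J where "J n = (SOME j. n \<in> C j)" for n
  have J: "J n = j" if "n \<in> C j" for n j
    unfolding J_def using that C_disj by (metis someI)
  have eq: "(\<Sum>n\<in>C j. \<psi> n (u (J n) n, v (J n) n)) = (\<Sum>n\<in>B j (m j). \<psi> n (u j n, v j n))" for j
    by (rule sum.cong) (use J in \<open>auto simp: C_def\<close>)
  show ?thesis
  proof (rule ell1_reducible_of_blocks[OF sc, where u = "\<lambda>n. u (J n) n" and v = "\<lambda>n. v (J n) n" and B = C])
    show "disjoint_family C" using C_disj by (auto simp: disjoint_family_on_def)
    show "finite (C j)" for j using C_sub finite_subset by blast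
    show "\<psi> n (u (J n) n, v (J n) n) \<le> (1/2) ^ j" if "n \<in> C j" for j n
      using J[OF that] KB(2)[of n j "m j"] that by (simp add: C_def)
    show "1 \<le> (\<Sum>n\<in>C j. \<psi> n (u (J n) n, v (J n) n))" "(\<Sum>n\<in>C j. \<psi> n (u (J n) n, v (J n) n)) \<le> 2" for j
      unfolding eq using KB by auto
  qed (use uv in auto)
qed

end

section \<open>The tail case: equivalence at almost all coordinates\<close>

locale tail_equiv = sum_equiv X \<psi> for X :: "nat \<Rightarrow> 'a topology" and \<psi> +
  fixes \<delta> :: real and s :: "nat \<Rightarrow> real"
  assumes \<delta>: "0 < \<delta>" and s: "summable s"
    and small: "\<And>n x y. x \<in> topspace (X n) \<Longrightarrow> y \<in> topspace (X n) \<Longrightarrow> \<psi> n (x, y) < \<delta> \<Longrightarrow> \<psi> n (x, y) \<le> s n"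
    and borel: "\<And>n. \<psi> n \<in> borel_of (prod_topology (X n) (X n)) \<rightarrow>\<^sub>M borel"
    and polish: "\<And>n. polish_topology (X n)"
begin

definition F :: "nat \<Rightarrow> ('a \<times> 'a) set" where
  "F n = {p \<in> topspace (prod_topology (X n) (X n)). \<psi> n p < \<delta>}"

lemma F_borel: "F n \<in> sets (borel_of (prod_topology (X n) (X n)))"
proof -
  note [measurable] = borel[of n]
  have "{p \<in> space (borel_of (prod_topology (X n) (X n))). \<psi> n p < \<delta>} \<in> sets (borel_of (prod_topology (X n) (X n)))"
    by measurable
  then show ?thesis by (simp add: F_def)
qed

text \<open>Summable terms are eventually below \<open>\<delta>\<close>; conversely, terms below
  \<open>\<delta>\<close> are dominated by \<open>s\<close>, and finitely many others do not affect
  summability.\<close>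

lemma E_iff_eventually:
  assumes x: "\<And>n. x n \<in> topspace (X n)" and y: "\<And>n. y n \<in> topspace (X n)"
  shows "(x, y) \<in> E \<longleftrightarrow> (\<forall>\<^sub>F n in sequentially. (x n, y n) \<in> F n)"
proof
  assume "(x, y) \<in> E"
  then have "(\<lambda>n. \<psi> n (x n, y n)) \<longlonglongrightarrow> 0"
    using E_iff[OF x y] summable_LIMSEQ_zero by blast
  then have "\<forall>\<^sub>F n in sequentially. \<psi> n (x n, y n) < \<delta>"
    using \<delta> by (rule order_tendstoD)
  then show "\<forall>\<^sub>F n in sequentially. (x n, y n) \<in> F n"
    by eventually_elim (use x y in \<open>simp add: F_def\<close>)
next
  assume "\<forall>\<^sub>F n in sequentially. (x n, y n) \<in> F n"
  then have "\<forall>\<^sub>F n in sequentially. norm (\<psi> n (x n, y n)) \<le> s n"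
    by eventually_elim (use x y small nonneg in \<open>simp add: F_def\<close>)
  then have "summable (\<lambda>n. \<psi> n (x n, y n))"
    using s by (rule summable_comparison_test_ev)
  then show "(x, y) \<in> E" using E_iff[OF x y] by blast
qed

text \<open>Failures at infinitely many \<open>n\<close> would assemble into points of the product
  at which \<open>E\<close> fails the same law. The instance selected at \<open>n\<close> is a
  failure if there is one, so its success gives the law for all of \<open>F n\<close>. Reflexivity
  is needed for the other two laws, whose selections are trivial instances where nothing
  fails.\<close>

lemma F_eventually_equiv: "\<forall>\<^sub>F n in sequentially. equiv (topspace (X n)) (F n)"
proof -
  define p where "p n = (SOME x. x \<in> topspace (X n))" for n
  have p: "p n \<in> topspace (X n)" for n
    unfolding p_def by (rule someI_ex) (use nonempty[of n] in blast)
  have refl: "\<forall>\<^sub>F n in sequentially. \<forall>x\<in>topspace (X n). (x, x) \<in> F n"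
  proof -
    have "\<exists>x. \<forall>n. x n \<in> topspace (X n) \<and> ((x n, x n) \<in> F n \<longrightarrow> (\<forall>x\<in>topspace (X n). (x, x) \<in> F n))"
      by (rule choice) (use nonempty in blast)
    then obtain x where x: "\<And>n. x n \<in> topspace (X n)"
      "\<And>n. (x n, x n) \<in> F n \<Longrightarrow> \<forall>x\<in>topspace (X n). (x, x) \<in> F n" by blast
    have "\<forall>\<^sub>F n in sequentially. (x n, x n) \<in> F n"
      using E_refl[OF x(1)] E_iff_eventually[OF x(1) x(1)] by blast
    then show ?thesis by eventually_elim (rule x(2))
  qed
  have sym: "\<forall>\<^sub>F n in sequentially. \<forall>x y. (x, y) \<in> F n \<longrightarrow> (y, x) \<in> F n"
  proof -
    have "\<forall>n. \<exists>z. fst z \<in> topspace (X n) \<and> snd z \<in> topspace (X n) \<and> (z \<in> F n \<or> fst z = snd z) \<and>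
      ((snd z, fst z) \<in> F n \<longrightarrow> (\<forall>x y. (x, y) \<in> F n \<longrightarrow> (y, x) \<in> F n))"
    proof
      fix n
      show "\<exists>z. fst z \<in> topspace (X n) \<and> snd z \<in> topspace (X n) \<and> (z \<in> F n \<or> fst z = snd z) \<and>
        ((snd z, fst z) \<in> F n \<longrightarrow> (\<forall>x y. (x, y) \<in> F n \<longrightarrow> (y, x) \<in> F n))"
      proof (cases "\<forall>x y. (x, y) \<in> F n \<longrightarrow> (y, x) \<in> F n")
        case True
        then show ?thesis using p[of n] by (intro exI[of _ "(p n, p n)"]) simp
      next
        case False
        then obtain x y where "(x, y) \<in> F n" "(y, x) \<notin> F n" by blast
        then show ?thesis by (intro exI[of _ "(x, y)"]) (simp add: F_def)
      qed
    qed
    from choice[OF this] obtain z where z: "\<And>n. fst (z n) \<in> topspace (X n)" "\<And>n. snd (z n) \<in> topspace (X n)"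
      "\<And>n. z n \<in> F n \<or> fst (z n) = snd (z n)"
      "\<And>n. (snd (z n), fst (z n)) \<in> F n \<Longrightarrow> \<forall>x y. (x, y) \<in> F n \<longrightarrow> (y, x) \<in> F n" by blast
    have "\<forall>\<^sub>F n in sequentially. (fst (z n), snd (z n)) \<in> F n"
      using refl by eventually_elim (use z in \<open>metis prod.collapse\<close>)
    then have "(\<lambda>n. fst (z n), \<lambda>n. snd (z n)) \<in> E"
      using E_iff_eventually[of "\<lambda>n. fst (z n)" "\<lambda>n. snd (z n)"] z by blast
    then have "(\<lambda>n. snd (z n), \<lambda>n. fst (z n)) \<in> E" by (rule E_sym)
    then have "\<forall>\<^sub>F n in sequentially. (snd (z n), fst (z n)) \<in> F n"
      using E_iff_eventually[of "\<lambda>n. snd (z n)" "\<lambda>n. fst (z n)"] z by blast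
    then show ?thesis by eventually_elim (rule z(4))
  qed
  have trans: "\<forall>\<^sub>F n in sequentially. \<forall>x y z. (x, y) \<in> F n \<longrightarrow> (y, z) \<in> F n \<longrightarrow> (x, z) \<in> F n"
  proof -
    have "\<forall>n. \<exists>a b c. a \<in> topspace (X n) \<and> b \<in> topspace (X n) \<and> c \<in> topspace (X n) \<and>
      ((a, b) \<in> F n \<or> a = b) \<and> ((b, c) \<in> F n \<or> b = c) \<and>
      ((a, c) \<in> F n \<longrightarrow> (\<forall>x y z. (x, y) \<in> F n \<longrightarrow> (y, z) \<in> F n \<longrightarrow> (x, z) \<in> F n))"
    proof
      fix n
      show "\<exists>a b c. a \<in> topspace (X n) \<and> b \<in> topspace (X n) \<and> c \<in> topspace (X n) \<and>
        ((a, b) \<in> F n \<or> a = b) \<and> ((b, c) \<in> F n \<or> b = c) \<and>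
        ((a, c) \<in> F n \<longrightarrow> (\<forall>x y z. (x, y) \<in> F n \<longrightarrow> (y, z) \<in> F n \<longrightarrow> (x, z) \<in> F n))"
      proof (cases "\<forall>x y z. (x, y) \<in> F n \<longrightarrow> (y, z) \<in> F n \<longrightarrow> (x, z) \<in> F n")
        case True
        then show ?thesis using p[of n] by (intro exI[of _ "p n"]) simp
      next
        case False
        then obtain x y z where "(x, y) \<in> F n" "(y, z) \<in> F n" "(x, z) \<notin> F n" by blast
        then show ?thesis by (intro exI[of _ x] exI[of _ y] exI[of _ z]) (simp add: F_def)
      qed
    qed
    then obtain a b c where a: "\<And>n. a n \<in> topspace (X n)" and b: "\<And>n. b n \<in> topspace (X n)"
      and c: "\<And>n. c n \<in> topspace (X n)"
      and ab: "\<And>n. (a n, b n) \<in> F n \<or> a n = b n" and bc: "\<And>n. (b n, c n) \<in> F n \<or> b n = c n"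
      and ac: "\<And>n. (a n, c n) \<in> F n \<Longrightarrow> \<forall>x y z. (x, y) \<in> F n \<longrightarrow> (y, z) \<in> F n \<longrightarrow> (x, z) \<in> F n"
      by metis
    have "\<forall>\<^sub>F n in sequentially. (a n, b n) \<in> F n" "\<forall>\<^sub>F n in sequentially. (b n, c n) \<in> F n"
      using refl by (eventually_elim, use ab bc a b in metis)+
    then have "(a, b) \<in> E" "(b, c) \<in> E"
      using E_iff_eventually[OF a b] E_iff_eventually[OF b c] by blast+
    then have "\<forall>\<^sub>F n in sequentially. (a n, c n) \<in> F n"
      using E_trans E_iff_eventually[OF a c] by blast
    then show ?thesis by eventually_elim (rule ac)
  qed
  show ?thesis
    using refl sym trans
  proof eventually_elim
    case (elim n)
    show ?case
    proof (rule equivI)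
      show "F n \<subseteq> topspace (X n) \<times> topspace (X n)" by (auto simp: F_def)
      show "refl_on (topspace (X n)) (F n)" using elim(1) by (auto simp: refl_on_def)
      show "sym (F n)" using elim(2) by (auto intro: symI)
      show "trans (F n)" using elim(3) by (meson transI)
    qed
  qed
qed

text \<open>For \<open>n \<ge> N\<close>, row \<open>n\<close> of the code has exactly one true
  entry, at the index of the class of \<open>x n\<close>. Inequivalent values thus change only two
  entries, and the codes differ finitely often exactly if finitely many rows differ. Rows below
  \<open>N\<close> are constantly false, since \<open>F n\<close> need not be an equivalence
  relation there.\<close>

lemma reducible_E0:
  assumes countable: "\<forall>\<^sub>F n in sequentially. \<exists>D. countable D \<and> (\<forall>x\<in>topspace (X n). \<exists>d\<in>D. (d, x) \<in> F n)"
  shows "borel_reducible (product_topology X UNIV) E cantor_topology E0"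
proof -
  obtain N where N: "\<And>n. N \<le> n \<Longrightarrow> equiv (topspace (X n)) (F n)"
    "\<And>n. N \<le> n \<Longrightarrow> \<exists>D. countable D \<and> (\<forall>x\<in>topspace (X n). \<exists>d\<in>D. (d, x) \<in> F n)"
    using eventually_conj[OF F_eventually_equiv countable] unfolding eventually_sequentially by blast
  have "\<exists>e :: nat \<Rightarrow> 'a. N \<le> n \<longrightarrow> (\<forall>x\<in>topspace (X n). \<exists>k. (e k, x) \<in> F n)" for n
  proof (cases "N \<le> n")
    case True
    then obtain D where D: "countable D" "\<forall>x\<in>topspace (X n). \<exists>d\<in>D. (d, x) \<in> F n" using N(2)[OF True] by blast
    have "\<exists>k. (from_nat_into D k, x) \<in> F n" if x: "x \<in> topspace (X n)" for x
    proof -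
      obtain d where d: "d \<in> D" "(d, x) \<in> F n" using bspec[OF D(2) x] by (rule bexE)
      obtain k where "from_nat_into D k = d" using from_nat_into_surj[OF D(1) d(1)] by (rule exE)
      with d(2) have "(from_nat_into D k, x) \<in> F n" by simp
      then show ?thesis by (rule exI)
    qed
    then show ?thesis by (intro exI[of _ "from_nat_into D"]) simp
  qed simp
  then obtain e :: "nat \<Rightarrow> nat \<Rightarrow> 'a" where e: "\<And>n x. N \<le> n \<Longrightarrow> x \<in> topspace (X n) \<Longrightarrow> \<exists>k. (e n k, x) \<in> F n"
    by metis
  \<comment> \<open>A class may be listed several times by \<open>e n\<close>; only its least index
    counts.\<close>
  define A where "A n k = {x \<in> topspace (X n). (e n k, x) \<in> F n \<and> (\<forall>j<k. (e n j, x) \<notin> F n)}" for n k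
  have A_ex: "\<exists>k. x \<in> A n k" if "N \<le> n" "x \<in> topspace (X n)" for n x
  proof (intro exI)
    show "x \<in> A n (LEAST k. (e n k, x) \<in> F n)"
      using LeastI_ex[OF e[OF that]] not_less_Least that by (auto simp: A_def)
  qed
  have A_unique: "i = j" if "x \<in> A n i" "x \<in> A n j" for n i j x
    using that unfolding A_def by (metis (mono_tags, lifting) linorder_neqE_nat mem_Collect_eq)
  have F_A: "y \<in> A n k" if "N \<le> n" "(x, y) \<in> F n" "x \<in> A n k" for n k x y
  proof -
    have "(z, x) \<in> F n \<longleftrightarrow> (z, y) \<in> F n" for z
      using N(1)[OF that(1)] that(2) by (meson equiv_def symE transE)
    then show ?thesis using that(2,3) by (auto simp: A_def F_def)
  qed
  have A_F: "(x, y) \<in> F n" if "N \<le> n" "x \<in> A n k" "y \<in> A n k" for n k x y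
    using N(1)[OF that(1)] that(2,3) unfolding A_def by (auto simp: equiv_def dest: symD transD)
  have A_borel: "A n k \<in> sets (borel_of (X n))" for n k
  proof -
    have sec: "{x \<in> topspace (X n). (z, x) \<in> F n} \<in> sets (borel_of (X n))" for z
    proof (cases "z \<in> topspace (X n)")
      case True
      then have "continuous_map (X n) (prod_topology (X n) (X n)) (\<lambda>x. (z, x))"
        by (intro continuous_map_pairedI) auto
      from measurable_sets[OF continuous_map_measurable[OF this] F_borel]
      show ?thesis by (simp add: vimage_def Int_def conj_commute)
    next
      case False
      then have "{x \<in> topspace (X n). (z, x) \<in> F n} = {}" by (auto simp: F_def)
      then show ?thesis by (simp only: sets.empty_sets)
    qed
    have "A n k = {x \<in> topspace (X n). (e n k, x) \<in> F n} - (\<Union>j\<in>{..<k}. {x \<in> topspace (X n). (e n j, x) \<in> F n})"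
      by (auto simp: A_def)
    also have "\<dots> \<in> sets (borel_of (X n))"
      by (intro sets.Diff sets.finite_UN sec) simp
    finally show ?thesis .
  qed
  define \<theta> where "\<theta> x m \<longleftrightarrow> N \<le> fst (prod_decode m) \<and> x (fst (prod_decode m)) \<in> A (fst (prod_decode m)) (snd (prod_decode m))"
    for x m
  have "\<theta> \<in> borel_of (product_topology X UNIV) \<rightarrow>\<^sub>M borel_of cantor_topology"
  proof (rule measurable_into_product_topology)
    show "second_countable (discrete_topology (UNIV :: bool set))"
      by (simp add: second_countable_discrete_topology)
    fix m
    have "(\<lambda>x. x n) -` A n k \<inter> space (borel_of (product_topology X UNIV)) \<in> sets (borel_of (product_topology X UNIV))" for n k
      using measurable_product_component A_borel by (rule measurable_sets)
    then have "Measurable.pred (borel_of (product_topology X UNIV)) (\<lambda>x. x n \<in> A n k)" for n k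
      unfolding pred_def by (simp only: vimage_def Int_def mem_Collect_eq conj_commute)
    then have "Measurable.pred (borel_of (product_topology X UNIV)) (\<lambda>x. \<theta> x m)"
      unfolding \<theta>_def by (intro pred_intros_logic) auto
    then show "(\<lambda>x. \<theta> x m) \<in> borel_of (product_topology X UNIV) \<rightarrow>\<^sub>M borel_of (discrete_topology UNIV)"
      by (rule measurable_borel_of_discrete)
  qed
  moreover have "(x, y) \<in> E \<longleftrightarrow> (\<theta> x, \<theta> y) \<in> E0"
    if "x \<in> topspace (product_topology X UNIV)" "y \<in> topspace (product_topology X UNIV)" for x y
  proof -
    have x: "x n \<in> topspace (X n)" and y: "y n \<in> topspace (X n)" for n
      using that by (auto simp: topspace_product_topology)
    have "(x, y) \<in> E \<longleftrightarrow> (\<forall>\<^sub>F n in sequentially. (x n, y n) \<in> F n)"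
      by (rule E_iff_eventually[OF x y])
    also have "\<dots> \<longleftrightarrow> finite {m. \<theta> x m \<noteq> \<theta> y m}"
    proof
      assume "\<forall>\<^sub>F n in sequentially. (x n, y n) \<in> F n"
      then obtain n0 where n0: "\<And>n. n0 \<le> n \<Longrightarrow> (x n, y n) \<in> F n"
        unfolding eventually_sequentially by blast
      have fin: "finite {k. z \<in> A n k}" for z n
      proof (cases "{k. z \<in> A n k} = {}")
        case True
        then show ?thesis by (simp only: finite.emptyI)
      next
        case False
        then obtain k where "z \<in> A n k" by blast
        then have "{k. z \<in> A n k} \<subseteq> {k}" using A_unique by blast
        then show ?thesis by (rule finite_subset) simp
      qed
      have "m \<in> prod_encode ` (SIGMA n:{..<n0}. {k. x n \<in> A n k} \<union> {k. y n \<in> A n k})"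
        if m: "\<theta> x m \<noteq> \<theta> y m" for m
      proof -
        obtain n k where nk: "prod_decode m = (n, k)" by fastforce
        have neq: "N \<le> n" "(x n \<in> A n k) \<noteq> (y n \<in> A n k)" using m nk by (auto simp: \<theta>_def)
        have "n < n0"
        proof (rule ccontr)
          assume "\<not> n < n0"
          then have "(x n, y n) \<in> F n" using n0 by simp
          then have "(y n, x n) \<in> F n" using N(1)[OF neq(1)] by (meson equiv_def symD)
          then show False using F_A[OF neq(1)] \<open>(x n, y n) \<in> F n\<close> neq(2) by blast
        qed
        then show ?thesis
          using neq nk by (intro image_eqI[of _ _ "(n, k)"]) (auto simp: prod_decode_inverse dest: sym)
      qed
      then have "{m. \<theta> x m \<noteq> \<theta> y m} \<subseteq> prod_encode ` (SIGMA n:{..<n0}. {k. x n \<in> A n k} \<union> {k. y n \<in> A n k})"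
        by blast
      then show "finite {m. \<theta> x m \<noteq> \<theta> y m}"
        by (rule finite_subset) (use fin in auto)
    next
      assume "finite {m. \<theta> x m \<noteq> \<theta> y m}"
      then have "finite ((fst \<circ> prod_decode) ` {m. \<theta> x m \<noteq> \<theta> y m})" by simp
      then obtain n0 where n0: "(fst \<circ> prod_decode) ` {m. \<theta> x m \<noteq> \<theta> y m} \<subseteq> {..<n0}"
        using finite_nat_bounded[THEN exE] by metis
      have "(x n, y n) \<in> F n" if n: "max N n0 \<le> n" for n
      proof -
        obtain k where k: "x n \<in> A n k" using A_ex[OF _ x] n by auto
        have "\<theta> x (prod_encode (n, k)) = \<theta> y (prod_encode (n, k))"
        proof (rule ccontr)
          assume "\<theta> x (prod_encode (n, k)) \<noteq> \<theta> y (prod_encode (n, k))"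
          then have "n \<in> (fst \<circ> prod_decode) ` {m. \<theta> x m \<noteq> \<theta> y m}"
            by (intro image_eqI[of _ _ "prod_encode (n, k)"]) auto
          then have "n < n0" using n0 by blast
          then show False using n by simp
        qed
        then have "y n \<in> A n k" using k n by (simp add: \<theta>_def)
        then show ?thesis using A_F k n by simp
      qed
      then show "\<forall>\<^sub>F n in sequentially. (x n, y n) \<in> F n"
        unfolding eventually_sequentially by blast
    qed
    also have "\<dots> \<longleftrightarrow> (\<theta> x, \<theta> y) \<in> E0" by (rule E0_iff_finite[symmetric])
    finally show ?thesis .
  qed
  ultimately show ?thesis unfolding borel_reducible_def by blast
qed

text \<open>Row \<open>n\<close> of the matrix determines coordinate \<open>n\<close> of
  \<open>\<Phi> x\<close> alone. As \<open>E\<close> ignores a single coordinate, changing one row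
  moves the image under the reduction by an l1 sequence, which is what
  \<open>exists_l1_close_flip\<close> requires.\<close>

lemma eventually_countable_classes:
  assumes red: "borel_reducible (product_topology X UNIV) E (powertop_real UNIV) RN_mod_ell1"
  shows "\<forall>\<^sub>F n in sequentially. \<exists>D. countable D \<and> (\<forall>x\<in>topspace (X n). \<exists>d\<in>D. (d, x) \<in> F n)"
proof (rule ccontr)
  define big where "big n \<longleftrightarrow> (\<forall>D. countable D \<longrightarrow> (\<exists>x\<in>topspace (X n). \<forall>d\<in>D. (d, x) \<notin> F n))" for n
  assume "\<not> ?thesis"
  then have freq: "\<exists>\<^sub>F n in sequentially. big n"
    unfolding frequently_def
  proof (rule contrapos_nn)
    assume "\<forall>\<^sub>F n in sequentially. \<not> big n"
    then show "\<forall>\<^sub>F n in sequentially. \<exists>D. countable D \<and> (\<forall>x\<in>topspace (X n). \<exists>d\<in>D. (d, x) \<in> F n)"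
      by eventually_elim (simp add: big_def)
  qed
  obtain N where N: "\<And>n. N \<le> n \<Longrightarrow> equiv (topspace (X n)) (F n)"
    using F_eventually_equiv unfolding eventually_sequentially by blast
  \<comment> \<open>The inequivalence clause is conditional so that a map exists for every
    \<open>n\<close>; where the premises fail, a constant map serves.\<close>
  define Q where "Q n \<phi> \<longleftrightarrow> (\<forall>\<alpha>. \<phi> \<alpha> \<in> topspace (X n)) \<and>
    (\<forall>U. openin (X n) U \<longrightarrow> (\<exists>L. \<phi> -` U = (\<Union>s\<in>L. {\<alpha>. \<forall>i < length s. \<alpha> i = s ! i}))) \<and>
    (N \<le> n \<longrightarrow> big n \<longrightarrow> (\<forall>\<alpha> i. \<not> \<alpha> i \<longrightarrow> (\<phi> \<alpha>, \<phi> (\<alpha>(i := True))) \<notin> F n))"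
    for n and \<phi> :: "(nat \<Rightarrow> bool) \<Rightarrow> 'a"
  have "\<exists>\<phi>. Q n \<phi>" for n
  proof (cases "N \<le> n \<and> big n")
    case True
    then have unc: "\<And>D. countable D \<Longrightarrow> \<exists>x\<in>topspace (X n). \<forall>d\<in>D. (d, x) \<notin> F n"
      unfolding big_def by blast
    show ?thesis
      by (rule polish_one_bit_inequivalent[OF polish[of n] N F_borel unc])
         (use True in \<open>auto simp: Q_def\<close>)
  next
    case False
    obtain p where p: "p \<in> topspace (X n)" using nonempty by blast
    have "\<exists>L. (\<lambda>_. p) -` U = (\<Union>s\<in>L. {\<alpha> :: nat \<Rightarrow> bool. \<forall>i < length s. \<alpha> i = s ! i})" for U
      by (rule exI[of _ "if p \<in> U then {[]} else {}"]) auto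
    then show ?thesis using p False unfolding Q_def by (intro exI[of _ "\<lambda>_. p"]) simp
  qed
  then obtain \<phi> where "\<And>n. Q n (\<phi> n)" by metis
  then have \<phi>: "\<And>n \<alpha>. \<phi> n \<alpha> \<in> topspace (X n)"
    and \<phi>_open: "\<And>n U. openin (X n) U \<Longrightarrow> \<exists>L. \<phi> n -` U = (\<Union>s\<in>L. {\<alpha>. \<forall>i < length s. \<alpha> i = s ! i})"
    and \<phi>_F: "\<And>n \<alpha> i. N \<le> n \<Longrightarrow> big n \<Longrightarrow> \<not> \<alpha> i \<Longrightarrow> (\<phi> n \<alpha>, \<phi> n (\<alpha>(i := True))) \<notin> F n"
    unfolding Q_def by simp_all
  define \<Phi> where "\<Phi> x n = \<phi> n (\<lambda>i. x (n, i))" for x :: "nat \<times> nat \<Rightarrow> bool" and n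
  have \<Phi>: "\<Phi> x n \<in> topspace (X n)" for x n by (simp add: \<Phi>_def \<phi>)
  then have \<Phi>_top: "\<Phi> x \<in> topspace (product_topology X UNIV)" for x
    by (auto simp: topspace_product_topology)
  have \<Phi>_meas: "\<Phi> \<in> bit_space \<rightarrow>\<^sub>M borel_of (product_topology X UNIV)"
  proof (rule measurable_into_product_topology)
    show "second_countable (X n)" for n by (rule polish_second_countable[OF polish])
    show "(\<lambda>x. \<Phi> x n) \<in> bit_space \<rightarrow>\<^sub>M borel_of (X n)" for n
    proof (rule measurable_borel_ofI)
      fix U assume U: "openin (X n) U"
      obtain L where L: "\<phi> n -` U = (\<Union>s\<in>L. {\<alpha>. \<forall>i < length s. \<alpha> i = s ! i})"
        using \<phi>_open[OF U] by (rule exE)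
      have "(\<lambda>x. \<Phi> x n) -` U \<inter> space bit_space = (\<lambda>x i. x (n, i)) -` (\<phi> n -` U)"
        by (auto simp: \<Phi>_def)
      also have "\<dots> = (\<Union>s\<in>L. {x. \<forall>i < length s. x (n, i) = s ! i})"
        unfolding L by auto
      also have "\<dots> \<in> sets bit_space"
      proof (rule sets.countable_UN'')
        show "countable L" by (rule countable_subset[OF subset_UNIV]) simp
        show "{x. \<forall>i < length s. x (n, i) = s ! i} \<in> sets bit_space" for s
          by (rule sets_bit_space_Collect) measurable
      qed
      finally show "(\<lambda>x. \<Phi> x n) -` U \<inter> space bit_space \<in> sets bit_space" .
    qed (use \<Phi> in auto)
  qed
  obtain \<theta> where \<theta>: "\<theta> \<in> borel_of (product_topology X UNIV) \<rightarrow>\<^sub>M borel_of (powertop_real UNIV)"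
    and \<theta>_red: "\<And>x y. x \<in> topspace (product_topology X UNIV) \<Longrightarrow> y \<in> topspace (product_topology X UNIV) \<Longrightarrow>
      (x, y) \<in> E \<longleftrightarrow> (\<theta> x, \<theta> y) \<in> RN_mod_ell1"
    using red unfolding borel_reducible_def by blast
  define h where "h k x = \<theta> (\<Phi> x) k" for k x
  have h_iff: "(\<Phi> x, \<Phi> y) \<in> E \<longleftrightarrow> summable (\<lambda>k. \<bar>h k x - h k y\<bar>)" for x y
    unfolding \<theta>_red[OF \<Phi>_top \<Phi>_top] by (simp add: RN_mod_ell1_def ell1_def h_def)
  obtain J x where Jx: "summable (\<lambda>k. \<bar>h k (flip (range (\<lambda>n. (n, J n))) x) - h k x\<bar>)"
  proof (rule exists_l1_close_flip)
    fix k :: nat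
    have "(\<lambda>x. x k) \<in> borel_of (powertop_real UNIV) \<rightarrow>\<^sub>M borel"
      using measurable_product_component[of k "\<lambda>_. euclideanreal"] by (simp add: borel_of_euclidean)
    from measurable_compose[OF measurable_compose[OF \<Phi>_meas \<theta>] this]
    show "h k \<in> borel_measurable bit_space" by (simp only: h_def[abs_def])
  next
    fix n and x y :: "nat \<times> nat \<Rightarrow> bool" assume xy: "\<And>i. fst i \<noteq> n \<Longrightarrow> x i = y i"
    have "\<forall>\<^sub>F m in sequentially. (\<Phi> x m, \<Phi> y m) \<in> F m"
      using eventually_ge_at_top[of "max N (Suc n)"]
    proof eventually_elim
      case (elim m)
      then have "\<Phi> y m = \<Phi> x m" using xy by (simp add: \<Phi>_def)
      then show ?case using N[of m] elim \<Phi> by (auto simp: equiv_def refl_on_def)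
    qed
    then have "(\<Phi> x, \<Phi> y) \<in> E" using E_iff_eventually[of "\<Phi> x" "\<Phi> y"] \<Phi> by blast
    then show "summable (\<lambda>k. \<bar>h k x - h k y\<bar>)" by (simp add: h_iff)
  qed blast
  define y where "y = flip (range (\<lambda>n. (n, J n))) x"
  have "(\<Phi> y, \<Phi> x) \<in> E" using Jx by (simp add: h_iff y_def)
  then have "\<forall>\<^sub>F n in sequentially. (\<Phi> y n, \<Phi> x n) \<in> F n"
    using E_iff_eventually[of "\<Phi> y" "\<Phi> x"] \<Phi> by blast
  then have "\<exists>\<^sub>F n in sequentially. big n \<and> (\<Phi> y n, \<Phi> x n) \<in> F n \<and> N \<le> n"
    using freq eventually_ge_at_top[of N] by (auto intro!: frequently_eventually_frequently eventually_conj)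
  then obtain n where n: "big n" "(\<Phi> y n, \<Phi> x n) \<in> F n" "N \<le> n"
    by (auto dest: frequently_ex)
  then have n': "(\<Phi> x n, \<Phi> y n) \<in> F n" using N by (meson equiv_def symD)
  have y: "y (n, i) = (if i = J n then \<not> x (n, i) else x (n, i))" for i
    by (auto simp: y_def flip_def)
  \<comment> \<open>The one-bit property speaks of turning a bit on, so the cases decide which of
    the two rows is the one before the change.\<close>
  show False
  proof (cases "x (n, J n)")
    case True
    then have "(\<lambda>i. x (n, i)) = (\<lambda>i. y (n, i))(J n := True)" "\<not> y (n, J n)" by (auto simp: y fun_eq_iff)
    then show False using \<phi>_F[OF n(3,1), of "\<lambda>i. y (n, i)" "J n"] n(2) by (simp add: \<Phi>_def)
  next
    case False
    then have "(\<lambda>i. y (n, i)) = (\<lambda>i. x (n, i))(J n := True)" by (auto simp: y fun_eq_iff)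
    then show False using \<phi>_F[OF n(3,1), of "\<lambda>i. x (n, i)" "J n"] n' False by (simp add: \<Phi>_def)
  qed
qed

end

section \<open>The dichotomy\<close>

theorem corollary2p11:
  fixes X :: "nat \<Rightarrow> 'a topology"
    and \<psi> :: "nat \<Rightarrow> 'a \<times> 'a \<Rightarrow> real"
  defines "E \<equiv> sum_rel (\<lambda>n. topspace (X n)) \<psi>"
  assumes polish: "\<And>n. polish_topology (X n)"
    and nonempty: "\<And>n. topspace (X n) \<noteq> {}"
    and borel: "\<And>n. \<psi> n \<in> borel_of (prod_topology (X n) (X n)) \<rightarrow>\<^sub>M borel"
    and nonneg: "\<And>n x y. x \<in> topspace (X n) \<Longrightarrow> y \<in> topspace (X n) \<Longrightarrow> 0 \<le> \<psi> n (x, y)"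
    and equiv: "equiv (topspace (product_topology X UNIV)) E"
    and reducible: "borel_reducible (product_topology X UNIV) E (powertop_real UNIV) RN_mod_ell1"
  shows "borel_reducible (product_topology X UNIV) E cantor_topology E0 \<or>
    borel_bireducible (product_topology X UNIV) E (powertop_real UNIV) RN_mod_ell1"
proof -
  interpret sum_equiv X \<psi>
    by unfold_locales (use nonempty nonneg equiv in \<open>auto simp: E_def\<close>)
  show ?thesis
  \<comment> \<open>The split does not involve the given reduction. In the tail case that reduction
    forces countably many classes at almost all coordinates; in the other case it is one half of the
    bireducibility.\<close>
  proof (cases "\<exists>\<delta> s. 0 < \<delta> \<and> summable s \<and>
      (\<forall>n. \<forall>x\<in>topspace (X n). \<forall>y\<in>topspace (X n). \<psi> n (x, y) < \<delta> \<longrightarrow> \<psi> n (x, y) \<le> s n)")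
    case True
    then obtain \<delta> s where ds: "0 < \<delta>" "summable s"
      "\<forall>n. \<forall>x\<in>topspace (X n). \<forall>y\<in>topspace (X n). \<psi> n (x, y) < \<delta> \<longrightarrow> \<psi> n (x, y) \<le> s n" by blast
    interpret tail_equiv X \<psi> \<delta> s
      by unfold_locales (use ds borel polish in auto)
    show ?thesis
      using reducible_E0[OF eventually_countable_classes] reducible unfolding E_def by blast
  next
    case False
    have "borel_reducible (powertop_real UNIV) RN_mod_ell1 (product_topology X UNIV) E"
      unfolding E_def
    proof (rule ell1_reducible_of_not_small)
      show "second_countable (X n)" for n by (rule polish_second_countable[OF polish])
      show "\<exists>n. \<exists>x\<in>topspace (X n). \<exists>y\<in>topspace (X n). \<psi> n (x, y) < \<delta> \<and> s n < \<psi> n (x, y)"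
        if "0 < \<delta>" "summable s" for \<delta> s
        using False that by (meson not_le)
    qed
    then show ?thesis using reducible unfolding borel_bireducible_def by blast
  qed
qed

end
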